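(* Let $(X,d,m)$ be a metric space with random walk, with invariant distribution $\nu$. Suppose that the Ricci curvature of $X$ is at least $\kappa>0$ and that $\sigma<\infty$. Suppose that $\nu$ is reversible, or that $X$ is finite. Then the spectral radius of the averaging operator $M$ acting on $L^2(X,\nu)/\{\mathrm{const}\}$ is at most $1-\kappa$.
   Context: $(X,d)$ is a Polish metric space with its Borel $\sigma$-algebra. A random walk $m$ on $X$ is a family of probability measures $(m_x)_{x\in X}$ on $X$, depending measurably on $x$, each having finite first moment. The $L^1$ transportation distance is $\mathcal{T}_1(\nu_1,\nu_2):=\inf_{\xi}\int_{X\times X} d(x,y)\,\mathrm{d}\xi(x,y)$, over all measures $\xi$ with marginals $\nu_1,\nu_2$. For distinct points $x,y$, $\kappa(x,y):=1-\frac{\mathcal{T}_1(m_x,m_y)}{d(x,y)}$; "the Ricci curvature of $X$ is at least $\kappa$" means $\kappa(x,y)\geq\kappa$ for all distinct $x,y$. A probability measure $\nu$ is invariant if $\mathrm{d}\nu(x)=\int_y\mathrm{d}\nu(y)\,\mathrm{d}m_y(x)$, and reversible if moreover $\mathrm{d}\nu(x)\,\mathrm{d}m_x(y)=\mathrm{d}\nu(y)\,\mathrm{d}m_y(x)$. The spread at $x$ is $\sigma(x):=\left(\frac12\iint d(y,z)^2\,\mathrm{d}m_x(y)\,\mathrm{d}m_x(z)\right)^{1/2}$, and the average spread is $\sigma:=\|\sigma(x)\|_{L^2(X,\nu)}$. The averaging operator is $Mf(x):=\int f(y)\,\mathrm{d}m_x(y)$. The space $L^2(X,\nu)/\{\mathrm{const}\}$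 carries the norm $\|f\|^2:=\|f-\int f\,\mathrm{d}\nu\|^2_{L^2(X,\nu)}=\mathrm{Var}_\nu f$. *)

theory Defs
  imports "HOL-Probability.Probability"
begin

subsection \<open>Random walks and their coarse Ricci curvature\<close>

definition random_walk :: "('a::polish_space \<Rightarrow> 'a measure) \<Rightarrow> bool" where
  "random_walk m \<longleftrightarrow>
     m \<in> borel \<rightarrow>\<^sub>M prob_algebra borel \<and> (\<forall>x. \<exists>z. integrable (m x) (\<lambda>y. dist z y))"

definition couplings :: "'a::polish_space measure \<Rightarrow> 'a measure \<Rightarrow> ('a \<times> 'a) measure set" where
  "couplings \<mu> \<nu> =
     {\<xi>. sets \<xi> = sets (borel \<Otimes>\<^sub>M borel) \<and> distr \<xi> borel fst = \<mu> \<and> distr \<xi> borel snd = \<nu>}"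

definition transport_dist :: "'a::polish_space measure \<Rightarrow> 'a measure \<Rightarrow> ennreal" where
  "transport_dist \<mu> \<nu> = (INF \<xi> \<in> couplings \<mu> \<nu>. \<integral>\<^sup>+ p. ennreal (dist (fst p) (snd p)) \<partial>\<xi>)"

text \<open>For a random walk the transportation distance of two steps is finite because of the first
  moment condition, so \<open>enn2real\<close> loses nothing here.\<close>

definition ricci :: "('a::polish_space \<Rightarrow> 'a measure) \<Rightarrow> 'a \<Rightarrow> 'a \<Rightarrow> real" where
  "ricci m x y = 1 - enn2real (transport_dist (m x) (m y)) / dist x y"

definition ricci_at_least :: "('a::polish_space \<Rightarrow> 'a measure) \<Rightarrow> real \<Rightarrow> bool" where
  "ricci_at_least m \<kappa> \<longleftrightarrow> (\<forall>x y. x \<noteq> y \<longrightarrow> ricci m x y \<ge> \<kappa>)"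

definition invariant_distribution ::
  "('a::polish_space \<Rightarrow> 'a measure) \<Rightarrow> 'a measure \<Rightarrow> bool" where
  "invariant_distribution m \<nu> \<longleftrightarrow> prob_space \<nu> \<and> sets \<nu> = sets borel \<and> \<nu> \<bind> m = \<nu>"

definition reversible :: "('a::polish_space \<Rightarrow> 'a measure) \<Rightarrow> 'a measure \<Rightarrow> bool" where
  "reversible m \<nu> \<longleftrightarrow> invariant_distribution m \<nu> \<and>
     \<nu> \<bind> (\<lambda>x. m x \<bind> (\<lambda>y. return (borel \<Otimes>\<^sub>M borel) (x, y))) =
     \<nu> \<bind> (\<lambda>y. m y \<bind> (\<lambda>x. return (borel \<Otimes>\<^sub>M borel) (x, y)))"

definition ennreal_sqrt :: "ennreal \<Rightarrow> ennreal" where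
  "ennreal_sqrt a = (if a = \<infinity> then \<infinity> else ennreal (sqrt (enn2real a)))"

definition spread :: "('a::polish_space \<Rightarrow> 'a measure) \<Rightarrow> 'a \<Rightarrow> ennreal" where
  "spread m x =
     ennreal_sqrt ((\<integral>\<^sup>+ z. (\<integral>\<^sup>+ y. ennreal ((dist y z)\<^sup>2) \<partial>m x) \<partial>m x) / 2)"

definition average_spread :: "('a::polish_space \<Rightarrow> 'a measure) \<Rightarrow> 'a measure \<Rightarrow> ennreal" where
  "average_spread m \<nu> = ennreal_sqrt (\<integral>\<^sup>+ x. (spread m x)\<^sup>2 \<partial>\<nu>)"

subsection \<open>The space \<open>L\<^sup>2(X, \<nu>)/{const}\<close>\<close>

text \<open>Functions are complex-valued, since spectra are taken over the complex numbers. Elements of the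
  quotient space are classes of square-integrable functions that differ by a constant almost
  everywhere.\<close>

definition L2_fun :: "'a measure \<Rightarrow> ('a \<Rightarrow> complex) set" where
  "L2_fun \<nu> = {f \<in> borel_measurable \<nu>. integrable \<nu> (\<lambda>x. (cmod (f x))\<^sup>2)}"

definition mod_const :: "'a measure \<Rightarrow> (('a \<Rightarrow> complex) \<times> ('a \<Rightarrow> complex)) set" where
  "mod_const \<nu> = {(f, g). f \<in> L2_fun \<nu> \<and> g \<in> L2_fun \<nu> \<and> (\<exists>c. AE x in \<nu>. f x = g x + c)}"

definition L2_mod_const :: "'a measure \<Rightarrow> ('a \<Rightarrow> complex) set set" where
  "L2_mod_const \<nu> = L2_fun \<nu> // mod_const \<nu>"

definition var_norm :: "'a measure \<Rightarrow> ('a \<Rightarrow> complex) \<Rightarrow> real" where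
  "var_norm \<nu> f = sqrt (\<integral>x. (cmod (f x - (\<integral>y. f y \<partial>\<nu>)))\<^sup>2 \<partial>\<nu>)"

text \<open>All representatives of a class have the same \<open>var_norm\<close>; see \<open>quot_norm_class\<close> below.\<close>

definition quot_norm :: "'a measure \<Rightarrow> ('a \<Rightarrow> complex) set \<Rightarrow> real" where
  "quot_norm \<nu> F = the_elem (var_norm \<nu> ` F)"

definition quot_map ::
  "'a measure \<Rightarrow> (('a \<Rightarrow> complex) \<Rightarrow> ('a \<Rightarrow> complex)) \<Rightarrow>
     ('a \<Rightarrow> complex) set \<Rightarrow> ('a \<Rightarrow> complex) set" where
  "quot_map \<nu> T F = (\<Union>f\<in>F. mod_const \<nu> `` {T f})"

definition averaging :: "('a \<Rightarrow> 'a measure) \<Rightarrow> ('a \<Rightarrow> complex) \<Rightarrow> ('a \<Rightarrow> complex)" where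
  "averaging m f = (\<lambda>x. \<integral>y. f y \<partial>m x)"

text \<open>\<open>z\<close> is a spectral value of the operator induced by \<open>T\<close> on \<open>L2_mod_const \<nu>\<close> unless \<open>z - T\<close> is a
  bijection with bounded inverse. The bound \<open>\<parallel>F\<parallel> \<le> C \<parallel>(z - T) F\<parallel>\<close> is boundedness of the inverse.\<close>

definition spectrum_mod_const ::
  "'a measure \<Rightarrow> (('a \<Rightarrow> complex) \<Rightarrow> ('a \<Rightarrow> complex)) \<Rightarrow> complex set" where
  "spectrum_mod_const \<nu> T =
     {z. \<not> (let S = quot_map \<nu> (\<lambda>f x. z * f x - T f x) in
            bij_betw S (L2_mod_const \<nu>) (L2_mod_const \<nu>) \<and>
            (\<exists>C. \<forall>F\<in>L2_mod_const \<nu>. quot_norm \<nu> F \<le> C * quot_norm \<nu> (S F)))}"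

text \<open>The supremum is taken in the extended reals. For a bounded operator the spectrum is empty only
  when the quotient space is trivial, and then the value is \<open>-\<infinity>\<close>. On a one-point space every
  lower curvature bound holds vacuously, so there \<open>1 - \<kappa>\<close> may be negative.\<close>

definition spectral_radius_mod_const ::
  "'a measure \<Rightarrow> (('a \<Rightarrow> complex) \<Rightarrow> ('a \<Rightarrow> complex)) \<Rightarrow> ereal" where
  "spectral_radius_mod_const \<nu> T = (SUP z \<in> spectrum_mod_const \<nu> T. ereal (cmod z))"

subsection \<open>Well-definedness\<close>

lemma L2_fun_add:
  assumes "f \<in> L2_fun \<nu>" "g \<in> L2_fun \<nu>"
  shows "(\<lambda>x. f x + g x) \<in> L2_fun \<nu>"
proof -
  have [measurable]: "f \<in> borel_measurable \<nu>" "g \<in> borel_measurable \<nu>"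
    using assms by (auto simp: L2_fun_def)
  have "integrable \<nu> (\<lambda>x. (cmod (f x + g x))\<^sup>2)"
  proof (rule Bochner_Integration.integrable_bound)
    show "integrable \<nu> (\<lambda>x. 2 * (cmod (f x))\<^sup>2 + 2 * (cmod (g x))\<^sup>2)"
      using assms by (auto simp: L2_fun_def)
    have "(cmod (f x + g x))\<^sup>2 \<le> 2 * (cmod (f x))\<^sup>2 + 2 * (cmod (g x))\<^sup>2" for x
    proof -
      have "(cmod (f x + g x))\<^sup>2 \<le> (cmod (f x) + cmod (g x))\<^sup>2"
        by (intro power_mono norm_triangle_ineq) auto
      also have "\<dots> \<le> 2 * (cmod (f x))\<^sup>2 + 2 * (cmod (g x))\<^sup>2"
        using sum_squares_bound[of "cmod (f x)" "cmod (g x)"] by (simp add: power2_sum)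
      finally show ?thesis .
    qed
    then show "AE x in \<nu>. norm ((cmod (f x + g x))\<^sup>2)
        \<le> norm (2 * (cmod (f x))\<^sup>2 + 2 * (cmod (g x))\<^sup>2)"
      by simp
  qed measurable
  then show ?thesis by (auto simp: L2_fun_def)
qed

lemma L2_fun_cmult:
  assumes "f \<in> L2_fun \<nu>"
  shows "(\<lambda>x. c * f x) \<in> L2_fun \<nu>"
  using assms by (auto simp: L2_fun_def norm_mult power_mult_distrib)

lemma L2_fun_integrable:
  assumes "prob_space \<nu>" "f \<in> L2_fun \<nu>"
  shows "integrable \<nu> f"
proof -
  interpret prob_space \<nu> by fact
  have [measurable]: "f \<in> borel_measurable \<nu>" using assms by (auto simp: L2_fun_def)
  show ?thesis
  proof (rule Bochner_Integration.integrable_bound)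
    show "integrable \<nu> (\<lambda>x. 1 + (cmod (f x))\<^sup>2)" using assms by (auto simp: L2_fun_def)
    have "cmod (f x) \<le> 1 + (cmod (f x))\<^sup>2" for x
      using sum_squares_bound[of "cmod (f x)" 1] norm_ge_zero[of "f x"]
      unfolding one_power2 mult_1_right by linarith
    then show "AE x in \<nu>. norm (f x) \<le> norm (1 + (cmod (f x))\<^sup>2)" by simp
  qed measurable
qed

lemma equiv_mod_const: "equiv (L2_fun \<nu>) (mod_const \<nu>)"
proof (rule equivI)
  show "mod_const \<nu> \<subseteq> L2_fun \<nu> \<times> L2_fun \<nu>" by (auto simp: mod_const_def)
  show "refl_on (L2_fun \<nu>) (mod_const \<nu>)"
    unfolding refl_on_def mod_const_def by (auto intro!: exI[of _ 0])
  show "sym (mod_const \<nu>)"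
  proof (rule symI)
    fix f g assume "(f, g) \<in> mod_const \<nu>"
    then obtain c where *: "f \<in> L2_fun \<nu>" "g \<in> L2_fun \<nu>" and "AE x in \<nu>. f x = g x + c"
      by (auto simp: mod_const_def)
    then have "AE x in \<nu>. g x = f x + (- c)"
      by (auto elim!: eventually_mono)
    with * show "(g, f) \<in> mod_const \<nu>" unfolding mod_const_def by blast
  qed
  show "trans (mod_const \<nu>)"
  proof (rule transI)
    fix f g h assume "(f, g) \<in> mod_const \<nu>" "(g, h) \<in> mod_const \<nu>"
    then obtain c d where *: "f \<in> L2_fun \<nu>" "h \<in> L2_fun \<nu>"
      and ae: "AE x in \<nu>. f x = g x + c" "AE x in \<nu>. g x = h x + d"
      by (auto simp: mod_const_def)
    from ae have "AE x in \<nu>. f x = h x + (d + c)"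
      by eventually_elim (simp add: add.assoc)
    with * show "(f, h) \<in> mod_const \<nu>" unfolding mod_const_def by blast
  qed
qed

lemma var_norm_cong:
  assumes "prob_space \<nu>" "(f, g) \<in> mod_const \<nu>"
  shows "var_norm \<nu> f = var_norm \<nu> g"
proof -
  interpret prob_space \<nu> by fact
  obtain c where fg: "f \<in> L2_fun \<nu>" "g \<in> L2_fun \<nu>" and ae: "AE x in \<nu>. f x = g x + c"
    using assms by (auto simp: mod_const_def)
  have [measurable]: "f \<in> borel_measurable \<nu>" "g \<in> borel_measurable \<nu>"
    using fg by (auto simp: L2_fun_def)
  have int: "integrable \<nu> g" by (rule L2_fun_integrable) fact+
  have "(\<integral>x. f x \<partial>\<nu>) = (\<integral>x. g x + c \<partial>\<nu>)" by (rule integral_cong_AE) (use ae in auto)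
  also have "\<dots> = (\<integral>x. g x \<partial>\<nu>) + c" using int by (simp add: prob_space)
  finally have "(\<integral>x. (cmod (f x - (\<integral>y. f y \<partial>\<nu>)))\<^sup>2 \<partial>\<nu>) = (\<integral>x. (cmod (g x - (\<integral>y. g y \<partial>\<nu>)))\<^sup>2 \<partial>\<nu>)"
    by (intro integral_cong_AE) (use ae in auto)
  then show ?thesis by (simp add: var_norm_def)
qed

lemma quot_norm_class:
  assumes "prob_space \<nu>" "f \<in> L2_fun \<nu>"
  shows "quot_norm \<nu> (mod_const \<nu> `` {f}) = var_norm \<nu> f"
proof -
  have "f \<in> mod_const \<nu> `` {f}" using equiv_class_self[OF equiv_mod_const assms(2)] .
  moreover have "var_norm \<nu> ` (mod_const \<nu> `` {f}) = (\<lambda>_. var_norm \<nu> f) ` (mod_const \<nu> `` {f})"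
  proof (rule image_cong[OF refl])
    fix g assume "g \<in> mod_const \<nu> `` {f}"
    then have "(f, g) \<in> mod_const \<nu>" by simp
    then show "var_norm \<nu> g = var_norm \<nu> f" by (rule var_norm_cong[OF assms(1), symmetric])
  qed
  ultimately have "var_norm \<nu> ` (mod_const \<nu> `` {f}) = {var_norm \<nu> f}"
    by (simp only: image_constant)
  then show ?thesis by (simp add: quot_norm_def)
qed

lemma averaging_L2_fun:
  fixes \<nu> :: "'a::polish_space measure"
  assumes "random_walk m" "invariant_distribution m \<nu>" "f \<in> L2_fun \<nu>"
  shows "averaging m f \<in> L2_fun \<nu>" and "AE x in \<nu>. integrable (m x) f"
proof -
  have m: "m \<in> borel \<rightarrow>\<^sub>M prob_algebra borel" using assms by (simp add: random_walk_def)
  have sets[measurable_cong]: "sets \<nu> = sets borel" and inv: "\<nu> \<bind> m = \<nu>" and "prob_space \<nu>"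
    using assms by (auto simp: invariant_distribution_def)
  have ms[measurable]: "m \<in> borel \<rightarrow>\<^sub>M subprob_algebra borel"
    using m by (rule measurable_prob_algebraD)
  have ms': "m \<in> \<nu> \<rightarrow>\<^sub>M subprob_algebra borel" by measurable
  have f[measurable]: "f \<in> borel_measurable borel"
    using assms(3) measurable_cong_sets[OF sets refl] by (auto simp: L2_fun_def)
  have mx: "prob_space (m x)" "sets (m x) = sets borel" for x
    using measurable_space[OF m, of x] by (auto simp: space_prob_algebra)
  have meas: "averaging m f \<in> borel_measurable borel" unfolding averaging_def by measurable
  have fin: "(\<integral>\<^sup>+x. (\<integral>\<^sup>+y. ennreal ((cmod (f y))\<^sup>2) \<partial>m x) \<partial>\<nu>) < \<infinity>"
  proof -
    have "(\<integral>\<^sup>+x. (\<integral>\<^sup>+y. ennreal ((cmod (f y))\<^sup>2) \<partial>m x) \<partial>\<nu>)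
        = (\<integral>\<^sup>+y. ennreal ((cmod (f y))\<^sup>2) \<partial>(\<nu> \<bind> m))"
      by (rule nn_integral_bind[symmetric, OF _ ms']) measurable
    also have "\<dots> = (\<integral>\<^sup>+y. ennreal ((cmod (f y))\<^sup>2) \<partial>\<nu>)" by (simp only: inv)
    also have "\<dots> < \<infinity>" using assms(3) by (auto simp: L2_fun_def integrable_iff_bounded)
    finally show ?thesis .
  qed
  have "AE x in \<nu>. (\<integral>\<^sup>+y. ennreal ((cmod (f y))\<^sup>2) \<partial>m x) \<noteq> \<infinity>"
    by (rule nn_integral_noteq_infinite) (use fin in auto)
  moreover have L2: "f \<in> L2_fun (m x)" if "(\<integral>\<^sup>+y. ennreal ((cmod (f y))\<^sup>2) \<partial>m x) \<noteq> \<infinity>" for x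
    using that mx(2)[of x] measurable_cong_sets[OF mx(2)[of x] refl]
    by (auto simp: L2_fun_def integrable_iff_bounded less_top)
  ultimately have ae: "AE x in \<nu>. f \<in> L2_fun (m x)" by (auto elim!: eventually_mono)
  then show "AE x in \<nu>. integrable (m x) f" by eventually_elim (rule L2_fun_integrable[OF mx(1)])
  have jensen: "ennreal ((cmod (averaging m f x))\<^sup>2) \<le> (\<integral>\<^sup>+y. ennreal ((cmod (f y))\<^sup>2) \<partial>m x)"
    if "f \<in> L2_fun (m x)" for x
  proof -
    interpret prob_space "m x" by (rule mx)
    have i: "integrable (m x) f" "integrable (m x) (\<lambda>y. (cmod (f y))\<^sup>2)"
      using L2_fun_integrable[OF mx(1) that] that by (auto simp: L2_fun_def)
    have "(cmod (averaging m f x))\<^sup>2 \<le> (\<integral>y. cmod (f y) \<partial>m x)\<^sup>2"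
      unfolding averaging_def by (intro power_mono integral_norm_bound) auto
    also have "\<dots> \<le> (\<integral>y. (cmod (f y))\<^sup>2 \<partial>m x)"
    proof -
      have "0 \<le> variance (\<lambda>y. cmod (f y))" by simp
      also have "\<dots> = (\<integral>y. (cmod (f y))\<^sup>2 \<partial>m x) - (\<integral>y. cmod (f y) \<partial>m x)\<^sup>2"
        by (rule variance_eq) (use i in auto)
      finally show ?thesis by simp
    qed
    finally show ?thesis using i by (simp add: nn_integral_eq_integral ennreal_leI)
  qed
  have "(\<integral>\<^sup>+x. ennreal ((cmod (averaging m f x))\<^sup>2) \<partial>\<nu>)
      \<le> (\<integral>\<^sup>+x. (\<integral>\<^sup>+y. ennreal ((cmod (f y))\<^sup>2) \<partial>m x) \<partial>\<nu>)"
    by (rule nn_integral_mono_AE) (use ae in \<open>auto elim!: eventually_mono intro: jensen\<close>)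
  with fin have "(\<integral>\<^sup>+x. ennreal ((cmod (averaging m f x))\<^sup>2) \<partial>\<nu>) < \<infinity>"
    by simp
  then show "averaging m f \<in> L2_fun \<nu>"
    using meas measurable_cong_sets[OF sets refl, of "borel :: complex measure"]
    by (auto simp: L2_fun_def integrable_iff_bounded)
qed

lemma averaging_mod_const:
  fixes \<nu> :: "'a::polish_space measure"
  assumes rw: "random_walk m" and inv: "invariant_distribution m \<nu>" and fg: "(f, g) \<in> mod_const \<nu>"
  shows "(averaging m f, averaging m g) \<in> mod_const \<nu>"
proof -
  obtain c where L: "f \<in> L2_fun \<nu>" "g \<in> L2_fun \<nu>" and ae: "AE x in \<nu>. f x = g x + c"
    using fg by (auto simp: mod_const_def)
  have m: "m \<in> borel \<rightarrow>\<^sub>M prob_algebra borel" using rw by (simp add: random_walk_def)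
  have sets: "sets \<nu> = sets borel" and bind: "\<nu> \<bind> m = \<nu>"
    using inv by (auto simp: invariant_distribution_def)
  have ms: "m \<in> \<nu> \<rightarrow>\<^sub>M subprob_algebra borel"
    using measurable_prob_algebraD[OF m] measurable_cong_sets[OF sets refl] by blast
  have mx: "prob_space (m x)" "sets (m x) = sets borel" for x
    using measurable_space[OF m, of x] by (auto simp: space_prob_algebra)
  have [measurable]: "f \<in> borel_measurable borel" "g \<in> borel_measurable borel"
    using L measurable_cong_sets[OF sets refl] by (auto simp: L2_fun_def)
  have "AE x in \<nu> \<bind> m. f x = g x + c" using ae by (simp only: bind)
  then have "AE x in \<nu>. AE y in m x. f y = g y + c"
    by (subst (asm) AE_bind[OF ms]) measurable
  then have "AE x in \<nu>. averaging m f x = averaging m g x + c"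
    using averaging_L2_fun(2)[OF rw inv L(1)] averaging_L2_fun(2)[OF rw inv L(2)]
  proof eventually_elim
    case (elim x)
    interpret prob_space "m x" by (rule mx)
    have "(\<integral>y. f y \<partial>m x) = (\<integral>y. g y + c \<partial>m x)"
      by (rule integral_cong_AE) (use elim in auto)
    then show ?case using elim by (simp add: averaging_def prob_space)
  qed
  then show ?thesis
    unfolding mod_const_def using averaging_L2_fun(1)[OF rw inv] L by blast
qed

lemma quot_map_shift_class:
  fixes \<nu> :: "'a::polish_space measure"
  assumes rw: "random_walk m" and inv: "invariant_distribution m \<nu>" and f: "f \<in> L2_fun \<nu>"
  defines "S \<equiv> (\<lambda>z f x. z * f x - averaging m f x)"
  shows "S z f \<in> L2_fun \<nu>"
    and "quot_map \<nu> (S z) (mod_const \<nu> `` {f}) = mod_const \<nu> `` {S z f}"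
proof -
  have S: "S z g \<in> L2_fun \<nu>" if "g \<in> L2_fun \<nu>" for g
    using L2_fun_add[OF L2_fun_cmult[OF that, of z]
        L2_fun_cmult[OF averaging_L2_fun(1)[OF rw inv that], of "-1"]]
    by (simp add: S_def)
  then show "S z f \<in> L2_fun \<nu>" using f .
  have "(S z g, S z h) \<in> mod_const \<nu>" if gh: "(g, h) \<in> mod_const \<nu>" for g h
  proof -
    obtain c d where L: "g \<in> L2_fun \<nu>" "h \<in> L2_fun \<nu>"
      and ae: "AE x in \<nu>. g x = h x + c"
      "AE x in \<nu>. averaging m g x = averaging m h x + d"
      using gh averaging_mod_const[OF rw inv gh] by (auto simp: mod_const_def)
    from ae have "AE x in \<nu>. S z g x = S z h x + (z * c - d)"
      by eventually_elim (simp add: S_def algebra_simps)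
    with S L show ?thesis unfolding mod_const_def by blast
  qed
  then have "(\<lambda>g. mod_const \<nu> `` {S z g}) respects mod_const \<nu>"
    by (intro congruentI equiv_class_eq[OF equiv_mod_const])
  then show "quot_map \<nu> (S z) (mod_const \<nu> `` {f}) = mod_const \<nu> `` {S z f}"
    unfolding quot_map_def by (rule UN_equiv_class[OF equiv_mod_const _ f])
qed

end

theory Submission
  imports Defs
begin

text \<open>Put \<open>r = 1 - \<kappa>\<close>. Integrating against couplings shows that \<open>M\<close> maps \<open>L\<close>-Lipschitz functions to
  \<open>r L\<close>-Lipschitz ones. For a bounded \<open>L\<close>-Lipschitz \<open>f\<close> the law of total variance
  \<open>Var f = \<integral> Var\<^bsub>m x\<^esub> f d\<nu> + Var (M f)\<close>, iterated along \<open>f, M f, M\<^sup>2 f, \<dots>\<close>, gives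
  \<open>Var f \<le> K L\<^sup>2\<close> with \<open>K\<close> finite because the average spread is; applied to \<open>M\<^sup>n f\<close> this yields
  \<open>\<parallel>M\<^sup>n f\<parallel> \<le> D L r\<^sup>n\<close>, with a constant that depends on \<open>f\<close> only through \<open>L\<close>.

  If \<open>\<nu>\<close> is reversible, \<open>M\<close> is self-adjoint, so \<open>n \<mapsto> \<parallel>M\<^sup>n f\<parallel>\<close> is log-convex and its decay rate \<open>r\<close> bounds
  already its first ratio: \<open>\<parallel>M f\<parallel> \<le> r \<parallel>f\<parallel>\<close>, first for bounded Lipschitz \<open>f\<close> and then, by density, on \<open>L\<^sup>2\<close>.
  If \<open>X\<close> is finite, every class has a representative whose Lipschitz constant is at most a fixed multiple
  of \<open>\<parallel>f\<parallel>\<close>. In both cases \<open>\<parallel>M\<^sup>n\<parallel> \<le> C r\<^sup>n\<close>, and \<open>z - M\<close> is inverted by the Neumann series for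
  \<open>\<bar>z\<bar> > r\<close>.\<close>

section \<open>The seminorm of \<open>L\<^sup>2\<close> modulo constants\<close>

definition l2_norm :: "'a measure \<Rightarrow> ('a \<Rightarrow> complex) \<Rightarrow> real" where
  "l2_norm \<mu> f = sqrt (\<integral>x. (cmod (f x))\<^sup>2 \<partial>\<mu>)"

lemma L2_fun_measurable: "f \<in> L2_fun \<mu> \<Longrightarrow> f \<in> borel_measurable \<mu>"
  by (simp add: L2_fun_def)

lemma L2_fun_integrable_square: "f \<in> L2_fun \<mu> \<Longrightarrow> integrable \<mu> (\<lambda>x. (cmod (f x))\<^sup>2)"
  by (simp add: L2_fun_def)

lemma L2_fun_diff:
  assumes "f \<in> L2_fun \<mu>" "g \<in> L2_fun \<mu>"
  shows "(\<lambda>x. f x - g x) \<in> L2_fun \<mu>"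
  using L2_fun_add[OF assms(1) L2_fun_cmult[OF assms(2), of "-1"]] by simp

lemma L2_fun_const: "prob_space \<mu> \<Longrightarrow> (\<lambda>x. c) \<in> L2_fun \<mu>"
  by (auto simp: L2_fun_def prob_space.finite_measure finite_measure.integrable_const)

lemma L2_fun_sum:
  assumes "prob_space \<mu>" "\<And>i. i \<in> I \<Longrightarrow> h i \<in> L2_fun \<mu>"
  shows "(\<lambda>x. \<Sum>i\<in>I. h i x) \<in> L2_fun \<mu>"
  using assms(2)
  by (induction I rule: infinite_finite_induct) (auto intro: L2_fun_add L2_fun_const[OF assms(1)])

lemma l2_norm_nonneg [simp]: "0 \<le> l2_norm \<mu> f"
  by (simp add: l2_norm_def)

lemma l2_norm_square: "(l2_norm \<mu> f)\<^sup>2 = (\<integral>x. (cmod (f x))\<^sup>2 \<partial>\<mu>)"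
  by (simp add: l2_norm_def)

lemma l2_norm_cmult: "l2_norm \<mu> (\<lambda>x. c * f x) = cmod c * l2_norm \<mu> f"
  by (simp add: l2_norm_def norm_mult power_mult_distrib real_sqrt_mult)

lemma nn_integral_square_l2_norm:
  assumes "f \<in> L2_fun \<mu>"
  shows "(\<integral>\<^sup>+x. ennreal ((cmod (f x))\<^sup>2) \<partial>\<mu>) = ennreal ((l2_norm \<mu> f)\<^sup>2)"
  using L2_fun_integrable_square[OF assms] by (simp add: l2_norm_square nn_integral_eq_integral)

text \<open>One estimate of the nonnegative integral, which needs no integrability in advance,
  yields membership and the norm bound together; this suits the Fatou and Jensen arguments
  below.\<close>

lemma L2_funI_nn_integral:
  assumes "f \<in> borel_measurable \<mu>" "(\<integral>\<^sup>+x. ennreal ((cmod (f x))\<^sup>2) \<partial>\<mu>) \<le> ennreal (B\<^sup>2)" "0 \<le> B"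
  shows "f \<in> L2_fun \<mu>" "l2_norm \<mu> f \<le> B"
proof -
  have "(\<integral>\<^sup>+x. ennreal ((cmod (f x))\<^sup>2) \<partial>\<mu>) < \<infinity>"
    using assms(2) by (rule order.strict_trans1) simp
  then show f: "f \<in> L2_fun \<mu>"
    using assms(1) by (auto simp: L2_fun_def integrable_iff_bounded)
  from assms(2) show "l2_norm \<mu> f \<le> B"
    unfolding nn_integral_square_l2_norm[OF f] using assms(3) by (simp add: power2_le_iff_abs_le)
qed

text \<open>The gap between the two sides is \<open>(b * s - a * t)^2 / (a * b)\<close>. Integrated
  with \<open>a\<close>, \<open>b\<close> close to the two norms, the inequality becomes
  Minkowski's.\<close>

lemma weighted_square_add:
  fixes s t a b :: real
  assumes "0 < a" "0 < b"
  shows "(s + t)\<^sup>2 \<le> (a + b) * (s\<^sup>2 / a + t\<^sup>2 / b)"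
proof -
  have "(a + b) * (s\<^sup>2 / a + t\<^sup>2 / b) - (s + t)\<^sup>2 = (b * s - a * t)\<^sup>2 / (a * b)"
    using assms by (simp add: field_simps power2_eq_square)
  moreover have "\<dots> \<ge> 0" using assms by simp
  ultimately show ?thesis by linarith
qed

lemma l2_norm_triangle:
  assumes f: "f \<in> L2_fun \<mu>" and g: "g \<in> L2_fun \<mu>"
  shows "l2_norm \<mu> (\<lambda>x. f x + g x) \<le> l2_norm \<mu> f + l2_norm \<mu> g"
proof (rule field_le_epsilon)
  fix e :: real assume e: "0 < e"
  \<comment> \<open>The optimal weights are the norms themselves; the summand \<open>e / 2\<close>
    keeps them positive when a norm vanishes.\<close>
  define a b where "a = l2_norm \<mu> f + e / 2" and "b = l2_norm \<mu> g + e / 2"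
  have ab: "0 < a" "0 < b" using e by (auto simp: a_def b_def intro: add_nonneg_pos)
  have "(\<integral>x. (cmod (f x + g x))\<^sup>2 \<partial>\<mu>)
      \<le> (\<integral>x. (a + b) * ((cmod (f x))\<^sup>2 / a + (cmod (g x))\<^sup>2 / b) \<partial>\<mu>)"
  proof (rule integral_mono)
    show "integrable \<mu> (\<lambda>x. (cmod (f x + g x))\<^sup>2)"
      using L2_fun_add[OF f g] by (rule L2_fun_integrable_square)
    show "integrable \<mu> (\<lambda>x. (a + b) * ((cmod (f x))\<^sup>2 / a + (cmod (g x))\<^sup>2 / b))"
      using f g by (auto simp: L2_fun_def)
    fix x
    have "(cmod (f x + g x))\<^sup>2 \<le> (cmod (f x) + cmod (g x))\<^sup>2"
      by (intro power_mono norm_triangle_ineq) auto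
    also have "\<dots> \<le> (a + b) * ((cmod (f x))\<^sup>2 / a + (cmod (g x))\<^sup>2 / b)"
      using ab by (rule weighted_square_add)
    finally show "(cmod (f x + g x))\<^sup>2 \<le> (a + b) * ((cmod (f x))\<^sup>2 / a + (cmod (g x))\<^sup>2 / b)" .
  qed
  also have "\<dots> = (a + b) * ((l2_norm \<mu> f)\<^sup>2 / a + (l2_norm \<mu> g)\<^sup>2 / b)"
    using f g by (simp add: L2_fun_def l2_norm_square)
  also have "\<dots> \<le> (a + b) * (a\<^sup>2 / a + b\<^sup>2 / b)"
    using ab e by (intro mult_left_mono add_mono divide_right_mono power_mono)
      (auto simp: a_def b_def)
  also have "\<dots> = (a + b)\<^sup>2" using ab by (simp add: power2_eq_square)
  finally have "l2_norm \<mu> (\<lambda>x. f x + g x) \<le> a + b"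
    unfolding l2_norm_def using ab by (simp add: real_le_lsqrt)
  then show "l2_norm \<mu> (\<lambda>x. f x + g x) \<le> l2_norm \<mu> f + l2_norm \<mu> g + e"
    by (simp add: a_def b_def)
qed

lemma l2_norm_Cauchy_Schwarz:
  assumes f: "f \<in> L2_fun \<mu>" and g: "g \<in> L2_fun \<mu>"
  shows "cmod (\<integral>x. f x * cnj (g x) \<partial>\<mu>) \<le> l2_norm \<mu> f * l2_norm \<mu> g"
proof -
  have bound: "cmod (\<integral>x. f x * cnj (g x) \<partial>\<mu>) \<le> (l2_norm \<mu> f + e) * (l2_norm \<mu> g + e)"
    if e: "0 < e" for e
  proof -
    define a b where "a = l2_norm \<mu> f + e" and "b = l2_norm \<mu> g + e"
    have ab: "0 < a" "0 < b" using e by (auto simp: a_def b_def intro: add_nonneg_pos)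
    \<comment> \<open>Weighted AM-GM, with weights near the two norms and shifted by
      \<open>e\<close> so that null functions cause no division by zero.\<close>
    have le: "s * t \<le> a * b / 2 * (s\<^sup>2 / a\<^sup>2 + t\<^sup>2 / b\<^sup>2)" for s t :: real
    proof -
      have "a * b / 2 * (s\<^sup>2 / a\<^sup>2 + t\<^sup>2 / b\<^sup>2) - s * t = a * b / 2 * (s / a - t / b)\<^sup>2"
        using ab by (simp add: field_simps power2_eq_square)
      moreover have "\<dots> \<ge> 0" using ab by simp
      ultimately show ?thesis by linarith
    qed
    have [measurable]: "f \<in> borel_measurable \<mu>" "g \<in> borel_measurable \<mu>"
      using f g by (auto simp: L2_fun_def)
    have "cmod (\<integral>x. f x * cnj (g x) \<partial>\<mu>) \<le> (\<integral>x. cmod (f x) * cmod (g x) \<partial>\<mu>)"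
      using integral_norm_bound[of \<mu> "\<lambda>x. f x * cnj (g x)"] by (simp add: norm_mult)
    also have "\<dots> \<le> (\<integral>x. a * b / 2 * ((cmod (f x))\<^sup>2 / a\<^sup>2 + (cmod (g x))\<^sup>2 / b\<^sup>2) \<partial>\<mu>)"
    proof (rule integral_mono')
      show "integrable \<mu> (\<lambda>x. a * b / 2 * ((cmod (f x))\<^sup>2 / a\<^sup>2 + (cmod (g x))\<^sup>2 / b\<^sup>2))"
        using f g by (auto simp: L2_fun_def)
      fix x
      show "0 \<le> a * b / 2 * ((cmod (f x))\<^sup>2 / a\<^sup>2 + (cmod (g x))\<^sup>2 / b\<^sup>2)"
        using ab by (intro mult_nonneg_nonneg add_nonneg_nonneg) auto
    qed (rule le)
    also have "\<dots> = a * b / 2 * ((l2_norm \<mu> f)\<^sup>2 / a\<^sup>2 + (l2_norm \<mu> g)\<^sup>2 / b\<^sup>2)"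
      using f g by (simp add: L2_fun_def l2_norm_square)
    also have "\<dots> \<le> a * b / 2 * (a\<^sup>2 / a\<^sup>2 + b\<^sup>2 / b\<^sup>2)"
      using ab e by (intro mult_left_mono add_mono divide_right_mono power_mono)
        (auto simp: a_def b_def)
    also have "\<dots> = a * b" using ab by simp
    finally show ?thesis by (simp add: a_def b_def)
  qed
  have lim: "((\<lambda>e. (l2_norm \<mu> f + e) * (l2_norm \<mu> g + e)) \<longlongrightarrow>
      (l2_norm \<mu> f + 0) * (l2_norm \<mu> g + 0)) (at_right 0)"
    by (intro tendsto_intros)
  have "cmod (\<integral>x. f x * cnj (g x) \<partial>\<mu>) \<le> (l2_norm \<mu> f + 0) * (l2_norm \<mu> g + 0)"
    by (rule tendsto_lowerbound[OF lim]) (auto simp: eventually_at_filter bound)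
  then show ?thesis by simp
qed

section \<open>The variance seminorm on a probability space\<close>

context prob_space
begin

lemma var_norm_nonneg [simp]: "0 \<le> var_norm M f"
  by (simp add: var_norm_def)

lemma var_norm_eq_l2_norm: "var_norm M f = l2_norm M (\<lambda>x. f x - expectation f)"
  by (simp add: var_norm_def l2_norm_def)

lemma L2_fun_center: "f \<in> L2_fun M \<Longrightarrow> (\<lambda>x. f x - expectation f) \<in> L2_fun M"
  by (intro L2_fun_diff L2_fun_const prob_space_axioms)

lemma expectation_L2_fun:
  assumes "f \<in> L2_fun M" shows "integrable M f"
  using L2_fun_integrable[OF prob_space_axioms assms] .

text \<open>Expand |f - c|^2 for c the mean: the cross term integrates to 2|c|^2. Both the variance
  and the squared mean are therefore at most the second moment.\<close>

lemma var_norm_square: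
  assumes f: "f \<in> L2_fun M"
  shows "(var_norm M f)\<^sup>2 = (l2_norm M f)\<^sup>2 - (cmod (expectation f))\<^sup>2"
proof -
  define c where "c = expectation f"
  have i: "integrable M f" using f by (rule expectation_L2_fun)
  have eq: "(cmod (f x - c))\<^sup>2 = (cmod (f x))\<^sup>2 - 2 * Re (f x * cnj c) + (cmod c)\<^sup>2" for x
    by (simp add: cmod_power2 power2_diff algebra_simps)
  have "(var_norm M f)\<^sup>2 = (\<integral>x. (cmod (f x))\<^sup>2 - 2 * Re (f x * cnj c) + (cmod c)\<^sup>2 \<partial>M)"
    by (simp add: var_norm_eq_l2_norm l2_norm_square eq flip: c_def)
  also have "\<dots> = (\<integral>x. (cmod (f x))\<^sup>2 \<partial>M) - 2 * (\<integral>x. Re (f x * cnj c) \<partial>M) + (cmod c)\<^sup>2"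
    using L2_fun_integrable_square[OF f] i by (simp add: prob_space)
  also have "(\<integral>x. Re (f x * cnj c) \<partial>M) = Re (\<integral>x. f x * cnj c \<partial>M)"
    using i by (intro integral_Re) simp
  also have "(\<integral>x. f x * cnj c \<partial>M) = c * cnj c" using i by (simp add: c_def)
  also have "Re (c * cnj c) = (cmod c)\<^sup>2" by (simp flip: complex_norm_square)
  finally show ?thesis by (simp add: l2_norm_square c_def)
qed

lemma var_norm_le_l2_norm:
  assumes "f \<in> L2_fun M" shows "var_norm M f \<le> l2_norm M f"
proof (rule power2_le_imp_le)
  show "(var_norm M f)\<^sup>2 \<le> (l2_norm M f)\<^sup>2"
    unfolding var_norm_square[OF assms] by simp
qed (rule l2_norm_nonneg)

lemma norm_expectation_le_l2_norm:
  assumes "f \<in> L2_fun M" shows "cmod (expectation f) \<le> l2_norm M f"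
proof (rule power2_le_imp_le)
  show "(cmod (expectation f))\<^sup>2 \<le> (l2_norm M f)\<^sup>2"
    using var_norm_square[OF assms] zero_le_power2[of "var_norm M f"] by linarith
qed (rule l2_norm_nonneg)

lemma var_norm_cmult:
  shows "var_norm M (\<lambda>x. c * f x) = cmod c * var_norm M f"
proof -
  have "(\<lambda>x. c * f x - expectation (\<lambda>x. c * f x)) = (\<lambda>x. c * (f x - expectation f))"
    by (simp add: right_diff_distrib)
  then show ?thesis unfolding var_norm_eq_l2_norm by (simp only: l2_norm_cmult)
qed

lemma var_norm_triangle:
  assumes f: "f \<in> L2_fun M" and g: "g \<in> L2_fun M"
  shows "var_norm M (\<lambda>x. f x + g x) \<le> var_norm M f + var_norm M g"
proof -
  have "(\<lambda>x. f x + g x - expectation (\<lambda>x. f x + g x))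
      = (\<lambda>x. (f x - expectation f) + (g x - expectation g))"
    using expectation_L2_fun[OF f] expectation_L2_fun[OF g] by (simp add: algebra_simps)
  then show ?thesis
    using l2_norm_triangle[OF L2_fun_center[OF f] L2_fun_center[OF g]]
    by (simp add: var_norm_eq_l2_norm)
qed

lemma var_norm_triangle_diff:
  assumes f: "f \<in> L2_fun M" and g: "g \<in> L2_fun M"
  shows "var_norm M (\<lambda>x. f x - g x) \<le> var_norm M f + var_norm M g"
  using var_norm_triangle[OF f L2_fun_cmult[OF g, of "-1"]] var_norm_cmult[of "-1" g] by simp

lemma var_norm_diff_const:
  assumes "f \<in> L2_fun M" shows "var_norm M (\<lambda>x. f x - c) = var_norm M f"
proof (rule var_norm_cong[OF prob_space_axioms])
  have "(\<lambda>x. f x - c) \<in> L2_fun M"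
    by (intro L2_fun_diff L2_fun_const assms prob_space_axioms)
  moreover have "AE x in M. f x - c = f x + (- c)" by simp
  ultimately show "(\<lambda>x. f x - c, f) \<in> mod_const M"
    unfolding mod_const_def using assms by blast
qed

text \<open>The variance ignores constants and is at most the second moment, so any convenient c may
  replace the mean; later c is a value of a function at a point.\<close>

lemma var_norm_le_l2_norm_diff:
  assumes "f \<in> L2_fun M" shows "var_norm M f \<le> l2_norm M (\<lambda>x. f x - c)"
  using var_norm_le_l2_norm[OF L2_fun_diff[OF assms L2_fun_const[OF prob_space_axioms]]]
  unfolding var_norm_diff_const[OF assms] .

lemma var_norm_eq_0D:
  assumes f: "f \<in> L2_fun M" and 0: "var_norm M f = 0"
  shows "AE x in M. f x = expectation f"
proof -
  have "(\<integral>x. (cmod (f x - expectation f))\<^sup>2 \<partial>M) = 0"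
    using 0 by (simp add: var_norm_def)
  then have "AE x in M. (cmod (f x - expectation f))\<^sup>2 = 0"
    using integral_nonneg_eq_0_iff_AE[OF L2_fun_integrable_square[OF L2_fun_center[OF f]]] by simp
  then show ?thesis by simp
qed

section \<open>Completeness\<close>

lemma l2_norm_sum:
  assumes "\<And>i. i \<in> I \<Longrightarrow> h i \<in> L2_fun M"
  shows "l2_norm M (\<lambda>x. \<Sum>i\<in>I. h i x) \<le> (\<Sum>i\<in>I. l2_norm M (h i))"
  using assms
proof (induction I rule: infinite_finite_induct)
  case (insert i I)
  have "l2_norm M (\<lambda>x. h i x + (\<Sum>i\<in>I. h i x)) \<le> l2_norm M (h i) + l2_norm M (\<lambda>x. \<Sum>i\<in>I. h i x)"
    using insert.prems by (intro l2_norm_triangle L2_fun_sum prob_space_axioms) auto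
  with insert show ?case by simp
qed (simp_all add: l2_norm_def)

text \<open>Riesz-Fischer in series form. The limit is the pointwise sum, and Fatou's lemma bounds
  the distance to every partial sum by the tail of the norms.\<close>

lemma L2_series_complete:
  fixes h :: "nat \<Rightarrow> 'a \<Rightarrow> complex"
  assumes h: "\<And>i. h i \<in> L2_fun M" and sum: "summable (\<lambda>i. l2_norm M (h i))"
  shows "\<exists>f\<in>L2_fun M. \<forall>n. l2_norm M (\<lambda>x. f x - (\<Sum>i<n. h i x)) \<le> (\<Sum>i. l2_norm M (h (i + n)))"
proof -
  have [measurable]: "h i \<in> borel_measurable M" for i using h by (rule L2_fun_measurable)
  define f where "f x = (\<Sum>i. h i x)" for x
  have [measurable]: "f \<in> borel_measurable M" unfolding f_def by measurable
  \<comment> \<open>On a probability space the L1 norm is at most the L2 norm. Hence the sum of the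
    |h i| has a finite integral and the series converges absolutely almost everywhere.\<close>
  have abs: "(\<integral>x. cmod (h i x) \<partial>M) \<le> l2_norm M (h i)" for i
  proof -
    have "(\<lambda>x. complex_of_real (cmod (h i x))) \<in> L2_fun M"
      using h[of i] by (auto simp: L2_fun_def)
    from norm_expectation_le_l2_norm[OF this] show ?thesis
      by (simp add: l2_norm_def)
  qed
  have "(\<integral>\<^sup>+x. (\<Sum>i. ennreal (cmod (h i x))) \<partial>M) = (\<Sum>i. \<integral>\<^sup>+x. ennreal (cmod (h i x)) \<partial>M)"
    by (rule nn_integral_suminf) measurable
  also have "\<dots> = (\<Sum>i. ennreal (\<integral>x. cmod (h i x) \<partial>M))"
    by (intro arg_cong[where f=suminf] ext nn_integral_eq_integral integrable_norm expectation_L2_fun h) auto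
  also have "\<dots> \<le> (\<Sum>i. ennreal (l2_norm M (h i)))"
    by (intro suminf_le) (auto intro: ennreal_leI abs)
  also have "\<dots> < \<infinity>"
    using sum by (simp add: ennreal_suminf_neq_top less_top[symmetric])
  finally have "AE x in M. (\<Sum>i. ennreal (cmod (h i x))) \<noteq> \<infinity>"
    by (intro nn_integral_noteq_infinite) auto
  then have summ: "AE x in M. summable (\<lambda>i. h i x)"
    by eventually_elim (auto intro!: summable_norm_cancel[OF summable_suminf_not_top])
  have key: "(\<lambda>x. f x - (\<Sum>i<n. h i x)) \<in> L2_fun M \<and>
      l2_norm M (\<lambda>x. f x - (\<Sum>i<n. h i x)) \<le> (\<Sum>i. l2_norm M (h (i + n)))" for n
  proof -
    let ?B = "\<Sum>i. l2_norm M (h (i + n))"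
    have sumn: "summable (\<lambda>i. l2_norm M (h (i + n)))" using sum by (subst summable_iff_shift)
    have B0: "0 \<le> ?B" using sumn by (intro suminf_nonneg) auto
    have part: "(\<integral>\<^sup>+x. ennreal ((cmod (\<Sum>i<k. h (i + n) x))\<^sup>2) \<partial>M) \<le> ennreal (?B\<^sup>2)" for k
    proof -
      have "l2_norm M (\<lambda>x. \<Sum>i<k. h (i + n) x) \<le> (\<Sum>i<k. l2_norm M (h (i + n)))"
        by (intro l2_norm_sum h)
      also have "\<dots> \<le> ?B" by (intro sum_le_suminf sumn) auto
      finally show ?thesis
        by (subst nn_integral_square_l2_norm[OF L2_fun_sum[OF prob_space_axioms h]])
           (auto intro!: ennreal_leI power_mono)
    qed
    \<comment> \<open>Almost everywhere the remainder is the limit of the finite sums bounded in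
      \<open>part\<close>, so its squared modulus is a \<open>liminf\<close>, to which Fatou
      applies.\<close>
    have "(\<integral>\<^sup>+x. ennreal ((cmod (f x - (\<Sum>i<n. h i x)))\<^sup>2) \<partial>M)
        = (\<integral>\<^sup>+x. liminf (\<lambda>k. ennreal ((cmod (\<Sum>i<k. h (i + n) x))\<^sup>2)) \<partial>M)"
    proof (rule nn_integral_cong_AE)
      show "AE x in M. ennreal ((cmod (f x - (\<Sum>i<n. h i x)))\<^sup>2)
          = liminf (\<lambda>k. ennreal ((cmod (\<Sum>i<k. h (i + n) x))\<^sup>2))"
        using summ
      proof eventually_elim
        case (elim x)
        have "(\<lambda>k. \<Sum>i<k. h (i + n) x) \<longlonglongrightarrow> (\<Sum>i. h (i + n) x)"
          using elim by (intro summable_LIMSEQ) (subst summable_iff_shift)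
        also have "(\<Sum>i. h (i + n) x) = f x - (\<Sum>i<n. h i x)"
          using suminf_split_initial_segment[OF elim, of n] by (simp add: f_def)
        finally have "(\<lambda>k. ennreal ((cmod (\<Sum>i<k. h (i + n) x))\<^sup>2))
            \<longlonglongrightarrow> ennreal ((cmod (f x - (\<Sum>i<n. h i x)))\<^sup>2)"
          by (intro tendsto_intros)
        from lim_imp_Liminf[OF _ this] show ?case by simp
      qed
    qed
    also have "\<dots> \<le> liminf (\<lambda>k. \<integral>\<^sup>+x. ennreal ((cmod (\<Sum>i<k. h (i + n) x))\<^sup>2) \<partial>M)"
      by (rule nn_integral_liminf) measurable
    also have "\<dots> \<le> ennreal (?B\<^sup>2)"
      by (rule Liminf_le) (auto intro: always_eventually part)
    finally show ?thesis
      using L2_funI_nn_integral[of "\<lambda>x. f x - (\<Sum>i<n. h i x)" M ?B] B0 by simp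
  qed
  \<comment> \<open>The empty partial sum, n = 0, gives membership of \<open>f\<close>
    itself.\<close>
  from key[of 0] key show ?thesis by auto
qed

text \<open>Each class modulo constants has a mean-zero representative, on which
  \<open>var_norm\<close> is \<open>l2_norm\<close>. Centring the terms thus reduces completeness of
  the quotient to completeness of L2.\<close>

lemma var_norm_series_complete:
  fixes h :: "nat \<Rightarrow> 'a \<Rightarrow> complex"
  assumes h: "\<And>i. h i \<in> L2_fun M" and sum: "summable (\<lambda>i. var_norm M (h i))"
  shows "\<exists>f\<in>L2_fun M. \<forall>n. var_norm M (\<lambda>x. f x - (\<Sum>i<n. h i x)) \<le> (\<Sum>i. var_norm M (h (i + n)))"
proof -
  define k where "k i x = h i x - expectation (h i)" for i x
  have k: "k i \<in> L2_fun M" for i unfolding k_def by (rule L2_fun_center[OF h])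
  have [simp]: "l2_norm M (k i) = var_norm M (h i)" for i
    by (simp add: k_def[abs_def] var_norm_eq_l2_norm)
  from L2_series_complete[of k] k sum obtain f where f: "f \<in> L2_fun M"
    and le: "\<And>n. l2_norm M (\<lambda>x. f x - (\<Sum>i<n. k i x)) \<le> (\<Sum>i. var_norm M (h (i + n)))"
    by auto
  have "var_norm M (\<lambda>x. f x - (\<Sum>i<n. h i x)) \<le> (\<Sum>i. var_norm M (h (i + n)))" for n
  proof -
    have "var_norm M (\<lambda>x. f x - (\<Sum>i<n. h i x))
        \<le> l2_norm M (\<lambda>x. f x - (\<Sum>i<n. h i x) - (- (\<Sum>i<n. expectation (h i))))"
      by (intro var_norm_le_l2_norm_diff L2_fun_diff f L2_fun_sum h prob_space_axioms)
    also have "\<dots> = l2_norm M (\<lambda>x. f x - (\<Sum>i<n. k i x))"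
      by (simp add: k_def sum_subtractf algebra_simps)
    finally show ?thesis using le[of n] by simp
  qed
  with f show ?thesis by blast
qed

end

section \<open>Density of bounded Lipschitz functions\<close>

text \<open>The bound \<open>B\<close> makes \<open>f\<close> square integrable against
  \<open>\<nu>\<close> and against every \<open>m x\<close>, and averaging preserves it, so
  integrability need not be tracked along the orbit of \<open>f\<close>.\<close>

definition bounded_lipschitz :: "real \<Rightarrow> real \<Rightarrow> ('a::metric_space \<Rightarrow> complex) \<Rightarrow> bool" where
  "bounded_lipschitz L B f \<longleftrightarrow> L-lipschitz_on UNIV f \<and> (\<forall>x. cmod (f x) \<le> B)"

lemma bounded_lipschitz_measurable:
  assumes "bounded_lipschitz L B f" shows "f \<in> borel_measurable borel"
  using assms lipschitz_on_continuous_on[of L UNIV f]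
  by (auto simp: bounded_lipschitz_def intro: borel_measurable_continuous_onI)

lemma bounded_lipschitz_add:
  assumes "bounded_lipschitz L B f" "bounded_lipschitz L' B' g"
  shows "bounded_lipschitz (L + L') (B + B') (\<lambda>x. f x + g x)"
  using assms unfolding bounded_lipschitz_def
  by (auto intro!: lipschitz_on_add norm_triangle_mono)

lemma bounded_lipschitz_const: "bounded_lipschitz 0 (cmod c) (\<lambda>x. c)"
  by (auto simp: bounded_lipschitz_def intro: lipschitz_onI)

lemma bounded_lipschitz_cmult:
  assumes "bounded_lipschitz L B f"
  shows "bounded_lipschitz (cmod c * L) (cmod c * B) (\<lambda>x. c * f x)"
proof -
  have "dist (c * f x) (c * f y) \<le> cmod c * L * dist x y" for x y
    using assms mult_left_mono[OF lipschitz_onD[of L UNIV f x y], of "cmod c"]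
    by (simp add: bounded_lipschitz_def dist_norm norm_mult mult.assoc flip: right_diff_distrib)
  moreover have "0 \<le> cmod c * L"
    using assms lipschitz_on_nonneg[of L UNIV f] by (simp add: bounded_lipschitz_def)
  ultimately show ?thesis
    using assms by (auto simp: bounded_lipschitz_def norm_mult intro!: lipschitz_onI mult_left_mono)
qed

lemma bounded_L2_fun:
  assumes "prob_space \<mu>" "f \<in> borel_measurable \<mu>" "\<And>x. cmod (f x) \<le> B"
  shows "f \<in> L2_fun \<mu>"
proof -
  interpret prob_space \<mu> by fact
  have "integrable \<mu> (\<lambda>x. (cmod (f x))\<^sup>2)"
    by (rule integrable_const_bound[where B = "B\<^sup>2"])
       (use assms in \<open>auto intro!: AE_I2 power_mono\<close>)
  with assms show ?thesis by (simp add: L2_fun_def)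
qed

lemma bounded_lipschitz_L2_fun:
  fixes \<nu> :: "'a::metric_space measure"
  assumes "prob_space \<nu>" "sets \<nu> = sets borel" "bounded_lipschitz L B f"
  shows "f \<in> L2_fun \<nu>"
proof (rule bounded_L2_fun[OF assms(1)])
  show "f \<in> borel_measurable \<nu>"
    unfolding measurable_cong_sets[OF assms(2) refl]
    using assms(3) by (rule bounded_lipschitz_measurable)
  show "cmod (f x) \<le> B" for x using assms(3) by (simp add: bounded_lipschitz_def)
qed

definition lipschitz_approximable :: "'a::metric_space measure \<Rightarrow> ('a \<Rightarrow> complex) \<Rightarrow> bool" where
  "lipschitz_approximable \<nu> f \<longleftrightarrow> f \<in> L2_fun \<nu> \<and>
     (\<forall>e>0. \<exists>L B h. bounded_lipschitz L B h \<and> l2_norm \<nu> (\<lambda>x. f x - h x) < e)"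

context
  fixes \<nu> :: "'a::polish_space measure"
  assumes prob: "prob_space \<nu>" and sets: "sets \<nu> = sets borel"
begin

lemma lipschitz_approximable_add:
  assumes "lipschitz_approximable \<nu> f" "lipschitz_approximable \<nu> g"
  shows "lipschitz_approximable \<nu> (\<lambda>x. f x + g x)"
  unfolding lipschitz_approximable_def
proof (intro conjI allI impI)
  have f: "f \<in> L2_fun \<nu>" and g: "g \<in> L2_fun \<nu>"
    using assms by (auto simp: lipschitz_approximable_def)
  then show "(\<lambda>x. f x + g x) \<in> L2_fun \<nu>" by (rule L2_fun_add)
  fix e :: real assume "0 < e"
  then have "0 < e / 2" by simp
  then obtain L B h L' B' k where h: "bounded_lipschitz L B h" "l2_norm \<nu> (\<lambda>x. f x - h x) < e / 2"
    and k: "bounded_lipschitz L' B' k" "l2_norm \<nu> (\<lambda>x. g x - k x) < e / 2"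
    using assms unfolding lipschitz_approximable_def by meson
  have "l2_norm \<nu> (\<lambda>x. (f x - h x) + (g x - k x)) < e"
    using l2_norm_triangle[OF L2_fun_diff[OF f bounded_lipschitz_L2_fun[OF prob sets h(1)]]
        L2_fun_diff[OF g bounded_lipschitz_L2_fun[OF prob sets k(1)]]] h(2) k(2)
    by simp
  also have "(\<lambda>x. (f x - h x) + (g x - k x)) = (\<lambda>x. f x + g x - (h x + k x))"
    by auto
  finally show "\<exists>L B h. bounded_lipschitz L B h \<and> l2_norm \<nu> (\<lambda>x. f x + g x - h x) < e"
    by (intro exI) (rule conjI[OF bounded_lipschitz_add[OF h(1) k(1)]])
qed

lemma lipschitz_approximable_cmult:
  assumes "lipschitz_approximable \<nu> f"
  shows "lipschitz_approximable \<nu> (\<lambda>x. c * f x)"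
  unfolding lipschitz_approximable_def
proof (intro conjI allI impI)
  show "(\<lambda>x. c * f x) \<in> L2_fun \<nu>"
    using assms by (auto simp: lipschitz_approximable_def intro: L2_fun_cmult)
  fix e :: real assume e: "0 < e"
  then have "0 < e / (cmod c + 1)" by (intro divide_pos_pos add_nonneg_pos) auto
  then obtain L B h where h: "bounded_lipschitz L B h" "l2_norm \<nu> (\<lambda>x. f x - h x) < e / (cmod c + 1)"
    using assms unfolding lipschitz_approximable_def by meson
  have "l2_norm \<nu> (\<lambda>x. c * (f x - h x)) = cmod c * l2_norm \<nu> (\<lambda>x. f x - h x)"
    by (rule l2_norm_cmult)
  also have "\<dots> \<le> cmod c * (e / (cmod c + 1))"
    using h(2) by (intro mult_left_mono) auto
  also have "\<dots> < e" using e by (simp add: divide_simps add_nonneg_pos)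
  finally have "l2_norm \<nu> (\<lambda>x. c * f x - c * h x) < e" by (simp add: right_diff_distrib)
  then show "\<exists>L B h. bounded_lipschitz L B h \<and> l2_norm \<nu> (\<lambda>x. c * f x - h x) < e"
    by (intro exI) (rule conjI[OF bounded_lipschitz_cmult[OF h(1)]])
qed

lemma lipschitz_approximable_sum:
  assumes "\<And>i. i \<in> I \<Longrightarrow> lipschitz_approximable \<nu> (f i)"
  shows "lipschitz_approximable \<nu> (\<lambda>x. \<Sum>i\<in>I. f i x)"
proof -
  have "lipschitz_approximable \<nu> (\<lambda>x. 0)"
    unfolding lipschitz_approximable_def
  proof (intro conjI allI impI exI)
    show "bounded_lipschitz 0 (cmod 0) (\<lambda>x::'a. 0)" by (rule bounded_lipschitz_const)
  qed (simp_all add: L2_fun_const[OF prob] l2_norm_def)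
  then show ?thesis
    using assms
    by (induction I rule: infinite_finite_induct) (auto intro: lipschitz_approximable_add)
qed

lemma lipschitz_approximable_limit:
  assumes s: "\<And>i. lipschitz_approximable \<nu> (s i)" and f: "f \<in> L2_fun \<nu>"
    and lim: "(\<lambda>i. l2_norm \<nu> (\<lambda>x. f x - s i x)) \<longlonglongrightarrow> 0"
  shows "lipschitz_approximable \<nu> f"
  unfolding lipschitz_approximable_def
proof (intro conjI allI impI f)
  fix e :: real assume "0 < e"
  then have e2: "0 < e / 2" by simp
  obtain i where i: "l2_norm \<nu> (\<lambda>x. f x - s i x) < e / 2"
    using order_tendstoD(2)[OF lim e2] by (auto simp: eventually_sequentially)
  obtain L B h where h: "bounded_lipschitz L B h" "l2_norm \<nu> (\<lambda>x. s i x - h x) < e / 2"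
    using s[of i] e2 unfolding lipschitz_approximable_def by meson
  have si: "s i \<in> L2_fun \<nu>" using s by (auto simp: lipschitz_approximable_def)
  have "l2_norm \<nu> (\<lambda>x. (f x - s i x) + (s i x - h x)) < e"
    using l2_norm_triangle[OF L2_fun_diff[OF f si]
        L2_fun_diff[OF si bounded_lipschitz_L2_fun[OF prob sets h(1)]]] i h(2)
    by simp
  with h(1) show "\<exists>L B h. bounded_lipschitz L B h \<and> l2_norm \<nu> (\<lambda>x. f x - h x) < e"
    by auto
qed

lemma l2_norm_dominated_convergence:
  fixes s :: "nat \<Rightarrow> 'a \<Rightarrow> complex"
  assumes [measurable]: "f \<in> borel_measurable \<nu>" "\<And>i. s i \<in> borel_measurable \<nu>"
    and lim: "\<And>x. (\<lambda>i. s i x) \<longlonglongrightarrow> f x"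
    and w: "integrable \<nu> w" "\<And>i x. (cmod (f x - s i x))\<^sup>2 \<le> w x"
  shows "(\<lambda>i. l2_norm \<nu> (\<lambda>x. f x - s i x)) \<longlonglongrightarrow> 0"
proof -
  have "(\<lambda>i. \<integral>x. (cmod (f x - s i x))\<^sup>2 \<partial>\<nu>) \<longlonglongrightarrow> (\<integral>x. 0 \<partial>\<nu>)"
  proof (rule integral_dominated_convergence[OF _ _ w(1)])
    show "AE x in \<nu>. (\<lambda>i. (cmod (f x - s i x))\<^sup>2) \<longlonglongrightarrow> 0"
    proof (rule AE_I2)
      fix x
      have "(\<lambda>i. (cmod (f x - s i x))\<^sup>2) \<longlonglongrightarrow> (cmod (f x - f x))\<^sup>2"
        by (intro tendsto_intros lim)
      then show "(\<lambda>i. (cmod (f x - s i x))\<^sup>2) \<longlonglongrightarrow> 0" by simp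
    qed
  qed (use w(2) in auto)
  then have "(\<lambda>i. sqrt (\<integral>x. (cmod (f x - s i x))\<^sup>2 \<partial>\<nu>)) \<longlonglongrightarrow> sqrt 0"
    by (intro tendsto_real_sqrt) simp
  then show ?thesis by (simp add: l2_norm_def)
qed

text \<open>The cutoffs max(0, 1 - n d(x, K)) are n-Lipschitz, equal 1 on K, and vanish for large n
  at each point off K because K is closed.\<close>

lemma lipschitz_approximable_indicator_compact:
  assumes K: "compact K"
  shows "lipschitz_approximable \<nu> (indicator K)"
\<comment> \<open>\<open>infdist x {}\<close> is 0 by convention, so the cutoffs of the empty set
  would be constantly 1.\<close>
proof (cases "K = {}")
  case True
  then show ?thesis
    using lipschitz_approximable_sum[of "{}"] by (simp add: indicator_def[abs_def])
next
  case False
  define s :: "nat \<Rightarrow> 'a \<Rightarrow> complex" where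
    "s n x = complex_of_real (max 0 (1 - real n * infdist x K))" for n x
  have [measurable]: "K \<in> sets borel" using K by (simp add: borel_closed compact_imp_closed)
  have bl: "bounded_lipschitz (real n) 1 (s n)" for n
  proof -
    have "dist (s n x) (s n y) \<le> real n * dist x y" for x y
    proof -
      have "dist (s n x) (s n y) \<le> \<bar>real n * infdist x K - real n * infdist y K\<bar>"
        by (simp add: s_def dist_norm flip: of_real_diff)
      also have "\<dots> = real n * \<bar>infdist x K - infdist y K\<bar>"
        by (simp add: abs_mult flip: right_diff_distrib)
      also have "\<dots> \<le> real n * dist x y"
        by (intro mult_left_mono infdist_triangle_abs) auto
      finally show ?thesis .
    qed
    then show ?thesis
      by (auto simp: bounded_lipschitz_def s_def infdist_nonneg intro!: lipschitz_onI)
  qed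
  have ind: "indicator K \<in> borel_measurable \<nu>"
    unfolding measurable_cong_sets[OF sets refl] by measurable
  show ?thesis
  proof (rule lipschitz_approximable_limit)
    show "lipschitz_approximable \<nu> (s n)" for n
      unfolding lipschitz_approximable_def
    proof (intro conjI allI impI)
      show "s n \<in> L2_fun \<nu>" by (rule bounded_lipschitz_L2_fun[OF prob sets bl])
      fix e :: real assume "0 < e"
      then have "bounded_lipschitz (real n) 1 (s n) \<and> l2_norm \<nu> (\<lambda>x. s n x - s n x) < e"
        using bl by (simp add: l2_norm_def)
      then show "\<exists>L B h. bounded_lipschitz L B h \<and> l2_norm \<nu> (\<lambda>x. s n x - h x) < e"
        by blast
    qed
    show "indicator K \<in> L2_fun \<nu>"
      by (rule bounded_L2_fun[OF prob ind, of 1]) (simp add: indicator_def)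
    show "(\<lambda>n. l2_norm \<nu> (\<lambda>x. indicator K x - s n x)) \<longlonglongrightarrow> 0"
    proof (rule l2_norm_dominated_convergence[OF ind])
      show "s n \<in> borel_measurable \<nu>" for n
        by (rule L2_fun_measurable[OF bounded_lipschitz_L2_fun[OF prob sets bl]])
      show "integrable \<nu> (\<lambda>x. 1 :: real)"
        using prob by (simp add: prob_space.finite_measure finite_measure.integrable_const)
      show "(cmod (indicator K x - s n x))\<^sup>2 \<le> 1" for n x
      proof (cases "x \<in> K")
        case True
        then show ?thesis by (simp add: s_def)
      next
        case False
        have "cmod (s n x) \<le> 1" using bl[of n] by (auto simp: bounded_lipschitz_def)
        with False show ?thesis by (simp add: power_le_one)
      qed
      show "(\<lambda>n. s n x) \<longlonglongrightarrow> indicator K x" for x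
      proof (cases "x \<in> K")
        case True
        then show ?thesis by (simp add: s_def)
      next
        case nK: False
        then have pos: "0 < infdist x K"
          using K False by (intro infdist_pos_not_in_closed compact_imp_closed) auto
        obtain N :: nat where N: "1 / infdist x K < real N" using reals_Archimedean2 by blast
        have "s n x = 0" if "N \<le> n" for n
        proof -
          have "1 < real N * infdist x K" using N pos by (simp add: field_simps)
          also have "\<dots> \<le> real n * infdist x K" using that pos by (intro mult_right_mono) auto
          finally show ?thesis by (simp add: s_def)
        qed
        then have "eventually (\<lambda>n. s n x = 0) sequentially"
          by (auto simp: eventually_sequentially)
        with nK show ?thesis by (simp add: tendsto_eventually)
      qed
    qed
  qed
qed

text \<open>Finite Borel measures on a Polish space are inner regular, so compact subsets exhaust A
  in measure; for nested sets the L2 distance of the indicators is the square root of the difference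
  in measure.\<close>

lemma lipschitz_approximable_indicator:
  assumes A: "A \<in> sets borel"
  shows "lipschitz_approximable \<nu> (indicator A)"
proof -
  interpret prob_space \<nu> by (rule prob)
  have "\<exists>K. K \<subseteq> A \<and> compact K \<and> prob A - prob K < e" if "0 < e" for e
  proof -
    have inner: "emeasure \<nu> A = (SUP K \<in> {K. K \<subseteq> A \<and> compact K}. emeasure \<nu> K)"
      by (rule inner_regular[OF sets _ A]) simp
    show ?thesis
    \<comment> \<open>For small \<open>prob A\<close> the empty set serves. Otherwise
      \<open>prob A - e\<close> is nonnegative, so \<open>ennreal\<close> does not truncate
      it.\<close>
    proof (cases "prob A < e")
      case True
      then show ?thesis by (intro exI[of _ "{}"]) auto
    next
      case False
      have "ennreal (prob A - e) < emeasure \<nu> A"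
        using that False by (simp add: emeasure_eq_measure ennreal_lessI)
      also note inner
      finally obtain K where K: "K \<subseteq> A" "compact K" "ennreal (prob A - e) < emeasure \<nu> K"
        by (auto simp: less_SUP_iff)
      from K(3) have "prob A - e < prob K"
        using False by (simp add: emeasure_eq_measure ennreal_less_iff)
      with K show ?thesis by (intro exI[of _ K]) auto
    qed
  qed
  then have "\<exists>K. K \<subseteq> A \<and> compact K \<and> prob A - prob K < inverse (real (Suc n))" for n
    by simp
  then obtain K where K: "\<And>n. K n \<subseteq> A" "\<And>n. compact (K n)"
    "\<And>n. prob A - prob (K n) < inverse (real (Suc n))"
    by metis
  have [measurable]: "A \<in> events" "\<And>n. K n \<in> events"
    using A K(2) by (auto simp: sets borel_closed compact_imp_closed)
  have norm: "l2_norm \<nu> (\<lambda>x. indicator A x - indicator (K n) x) = sqrt (prob A - prob (K n))" for n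
  proof -
    have "(\<integral>x. (cmod (indicator A x - indicator (K n) x))\<^sup>2 \<partial>\<nu>) = (\<integral>x. indicator (A - K n) x \<partial>\<nu>)"
      using K(1)[of n] by (intro Bochner_Integration.integral_cong) (auto simp: indicator_def)
    also have "\<dots> = prob A - prob (K n)"
      using K(1) by (simp add: finite_measure_Diff)
    finally show ?thesis by (simp add: l2_norm_def)
  qed
  show ?thesis
  proof (rule lipschitz_approximable_limit)
    show "lipschitz_approximable \<nu> (indicator (K n))" for n
      by (rule lipschitz_approximable_indicator_compact[OF K(2)])
    show "indicator A \<in> L2_fun \<nu>"
      by (rule bounded_L2_fun[OF prob, of _ 1]) (auto simp: indicator_def)
    have "(\<lambda>n. prob A - prob (K n)) \<longlonglongrightarrow> 0"
    proof (rule real_tendsto_sandwich[OF _ _ tendsto_const LIMSEQ_inverse_real_of_nat])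
      show "\<forall>\<^sub>F n in sequentially. 0 \<le> prob A - prob (K n)"
        using K(1) by (auto intro!: always_eventually finite_measure_mono)
      show "\<forall>\<^sub>F n in sequentially. prob A - prob (K n) \<le> inverse (real (Suc n))"
        using K(3) by (auto intro!: always_eventually less_imp_le)
    qed
    from tendsto_real_sqrt[OF this]
    show "(\<lambda>n. l2_norm \<nu> (\<lambda>x. indicator A x - indicator (K n) x)) \<longlonglongrightarrow> 0"
      unfolding norm by simp
  qed
qed

lemma L2_lipschitz_approximable:
  assumes f: "f \<in> L2_fun \<nu>"
  shows "lipschitz_approximable \<nu> f"
proof -
  have fm: "f \<in> borel_measurable \<nu>" using f by (rule L2_fun_measurable)
  have sp: "space \<nu> = UNIV" using sets_eq_imp_space_eq[OF sets] by simp
  \<comment> \<open>Simple functions with |s i| at most 2|f| converge pointwise to f. The error is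
    at most 3|f|, whence the dominating function 9|f|^2 below.\<close>
  obtain s where s: "\<And>i. simple_function \<nu> (s i)" "\<And>x. (\<lambda>i. s i x) \<longlonglongrightarrow> f x"
    "\<And>i x. cmod (s i x) \<le> 2 * cmod (f x)"
    using borel_measurable_implies_sequence_metric[OF fm, of 0] sp
    unfolding norm_conv_dist by auto
  show ?thesis
  proof (rule lipschitz_approximable_limit[OF _ f])
    show "lipschitz_approximable \<nu> (s i)" for i
    proof -
      have fin: "finite (range (s i))"
        using simple_functionD(1)[OF s(1)[of i]] sp by simp
      have "s i x = (\<Sum>c\<in>range (s i). c * indicator (s i -` {c}) x)" for x
      proof -
        have "(\<Sum>c\<in>range (s i). c * indicator (s i -` {c}) x)
            = (\<Sum>c\<in>range (s i). if c = s i x then c else 0)"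
          by (intro sum.cong) (auto simp: indicator_def)
        also have "\<dots> = s i x" using fin by simp
        finally show ?thesis by simp
      qed
      then have eq: "s i = (\<lambda>x. \<Sum>c\<in>range (s i). c * indicator (s i -` {c}) x)" by blast
      have "s i -` {c} \<in> sets borel" for c
        using simple_functionD(2)[OF s(1)[of i], of "{c}"] by (simp add: sp sets)
      then have "lipschitz_approximable \<nu> (\<lambda>x. \<Sum>c\<in>range (s i). c * indicator (s i -` {c}) x)"
        by (intro lipschitz_approximable_sum lipschitz_approximable_cmult
            lipschitz_approximable_indicator)
      with eq show ?thesis by metis
    qed
    show "(\<lambda>i. l2_norm \<nu> (\<lambda>x. f x - s i x)) \<longlonglongrightarrow> 0"
    proof (rule l2_norm_dominated_convergence[OF fm _ s(2)])
      show "s i \<in> borel_measurable \<nu>" for i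
        by (rule borel_measurable_simple_function[OF s(1)])
      show "integrable \<nu> (\<lambda>x. 9 * (cmod (f x))\<^sup>2)"
        using L2_fun_integrable_square[OF f] by simp
      show "(cmod (f x - s i x))\<^sup>2 \<le> 9 * (cmod (f x))\<^sup>2" for i x
      proof -
        have "cmod (f x - s i x) \<le> 3 * cmod (f x)"
          using norm_triangle_ineq4[of "f x" "s i x"] s(3)[of i x] by simp
        from power_mono[OF this, of 2] show ?thesis by (simp add: power_mult_distrib)
      qed
    qed
  qed
qed

end

section \<open>Averaging under an invariant distribution\<close>

lemma product_in_couplings:
  fixes \<mu> \<nu> :: "'a::polish_space measure"
  assumes "prob_space \<mu>" "prob_space \<nu>" and sets: "sets \<mu> = sets borel" "sets \<nu> = sets borel"
  shows "\<mu> \<Otimes>\<^sub>M \<nu> \<in> couplings \<mu> \<nu>"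
proof -
  interpret M: prob_space \<mu> by fact
  interpret N: prob_space \<nu> by fact
  interpret pair_sigma_finite \<mu> \<nu> ..
  have "distr (\<mu> \<Otimes>\<^sub>M \<nu>) \<nu> snd = distr (distr (\<nu> \<Otimes>\<^sub>M \<mu>) (\<mu> \<Otimes>\<^sub>M \<nu>) (\<lambda>(x, y). (y, x))) \<nu> snd"
    by (subst distr_pair_swap) rule
  also have "\<dots> = distr (\<nu> \<Otimes>\<^sub>M \<mu>) \<nu> (snd \<circ> (\<lambda>(x, y). (y, x)))"
    by (rule distr_distr) measurable
  also have "snd \<circ> (\<lambda>(x, y). (y, x)) = fst" by auto
  also have "distr (\<nu> \<Otimes>\<^sub>M \<mu>) \<nu> fst = \<nu>" by (rule M.distr_pair_fst)
  finally have "distr (\<mu> \<Otimes>\<^sub>M \<nu>) borel snd = \<nu>"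
    using distr_cong[OF refl sets(2), of "\<mu> \<Otimes>\<^sub>M \<nu>" snd snd] by simp
  moreover have "distr (\<mu> \<Otimes>\<^sub>M \<nu>) borel fst = \<mu>"
    using distr_cong[OF refl sets(1), of "\<mu> \<Otimes>\<^sub>M \<nu>" fst fst] N.distr_pair_fst[of \<mu>] by simp
  ultimately show ?thesis
    by (simp add: couplings_def sets_pair_measure_cong[OF sets])
qed

text \<open>The product coupling already has finite cost, by the triangle inequality through the
  base points \<open>z\<close> and \<open>w\<close>. This justifies the passage through
  \<open>enn2real\<close> in \<open>ricci\<close>.\<close>

lemma transport_dist_finite:
  fixes \<mu> \<nu> :: "'a::polish_space measure"
  assumes prob: "prob_space \<mu>" "prob_space \<nu>" and sets: "sets \<mu> = sets borel" "sets \<nu> = sets borel"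
    and mom: "integrable \<mu> (dist z)" "integrable \<nu> (dist w)"
  shows "transport_dist \<mu> \<nu> < \<infinity>"
proof -
  interpret M: prob_space \<mu> by fact
  interpret N: prob_space \<nu> by fact
  interpret pair_sigma_finite \<mu> \<nu> ..
  note [measurable_cong] = sets
  have fin: "(\<integral>\<^sup>+x. ennreal (dist z x) \<partial>\<mu>) < \<infinity>" "(\<integral>\<^sup>+y. ennreal (dist w y) \<partial>\<nu>) < \<infinity>"
    using mom by (auto simp: integrable_iff_bounded)
  have "transport_dist \<mu> \<nu> \<le> (\<integral>\<^sup>+p. ennreal (dist (fst p) (snd p)) \<partial>(\<mu> \<Otimes>\<^sub>M \<nu>))"
    unfolding transport_dist_def by (rule INF_lower[OF product_in_couplings[OF prob sets]])
  also have "\<dots> \<le> (\<integral>\<^sup>+p. ennreal (dist z (fst p)) + (ennreal (dist z w) + ennreal (dist w (snd p))) \<partial>(\<mu> \<Otimes>\<^sub>M \<nu>))"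
  proof (rule nn_integral_mono)
    fix p :: "'a \<times> 'a"
    have "dist (fst p) (snd p) \<le> dist z (fst p) + (dist z w + dist w (snd p))"
      by metric
    then show "ennreal (dist (fst p) (snd p))
        \<le> ennreal (dist z (fst p)) + (ennreal (dist z w) + ennreal (dist w (snd p)))"
      by (simp flip: ennreal_plus add: ennreal_leI)
  qed
  also have "\<dots> = (\<integral>\<^sup>+x. \<integral>\<^sup>+y. ennreal (dist z x) + (ennreal (dist z w) + ennreal (dist w y)) \<partial>\<nu> \<partial>\<mu>)"
    by (subst N.nn_integral_fst[symmetric]) auto
  also have "\<dots> = (\<integral>\<^sup>+x. ennreal (dist z x) \<partial>\<mu>) + (ennreal (dist z w) + (\<integral>\<^sup>+y. ennreal (dist w y) \<partial>\<nu>))"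
    by (simp add: nn_integral_add M.emeasure_space_1 N.emeasure_space_1)
  also have "\<dots> < \<infinity>" using fin by simp
  finally show ?thesis .
qed

text \<open>The easy half of Kantorovich duality: under any coupling the difference of the integrals
  is the integral of f(x) - f(y), and this integrand is at most L d(x, y) in modulus.\<close>

lemma lipschitz_integral_transport_dist:
  fixes f :: "'a::polish_space \<Rightarrow> complex"
  assumes prob: "prob_space \<mu>" and bl: "bounded_lipschitz L B f" and L: "0 < L"
  shows "ennreal (cmod ((\<integral>x. f x \<partial>\<mu>) - (\<integral>x. f x \<partial>\<nu>)) / L) \<le> transport_dist \<mu> \<nu>"
  unfolding transport_dist_def
proof (rule INF_greatest)
  fix \<xi> assume "\<xi> \<in> couplings \<mu> \<nu>"
  then have [measurable_cong]: "sets \<xi> = sets (borel \<Otimes>\<^sub>M borel)"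
    and marg: "distr \<xi> borel fst = \<mu>" "distr \<xi> borel snd = \<nu>"
    by (auto simp: couplings_def)
  have [measurable]: "f \<in> borel_measurable borel" by (rule bounded_lipschitz_measurable[OF bl])
  have fB: "cmod (f x) \<le> B" for x using bl by (simp add: bounded_lipschitz_def)
  \<comment> \<open>A coupling inherits its total mass from its first marginal.\<close>
  interpret prob_space \<xi>
    by (rule prob_space_distrD[of fst _ borel]) (use marg prob in auto)
  have int: "integrable \<xi> (\<lambda>p. f (fst p))" "integrable \<xi> (\<lambda>p. f (snd p))"
    by (rule integrable_const_bound[where B=B]; use fB in simp)+
  have "(\<integral>x. f x \<partial>\<mu>) = (\<integral>p. f (fst p) \<partial>\<xi>)"
    unfolding marg(1)[symmetric] by (rule integral_distr) measurable
  moreover have "(\<integral>x. f x \<partial>\<nu>) = (\<integral>p. f (snd p) \<partial>\<xi>)"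
    unfolding marg(2)[symmetric] by (rule integral_distr) measurable
  ultimately have "(\<integral>x. f x \<partial>\<mu>) - (\<integral>x. f x \<partial>\<nu>) = (\<integral>p. f (fst p) - f (snd p) \<partial>\<xi>)"
    using int by simp
  then have "ennreal (cmod ((\<integral>x. f x \<partial>\<mu>) - (\<integral>x. f x \<partial>\<nu>)) / L)
      = ennreal (norm (\<integral>p. (f (fst p) - f (snd p)) / complex_of_real L \<partial>\<xi>))"
    using L by (simp add: norm_divide)
  also have "\<dots> \<le> (\<integral>\<^sup>+p. ennreal (norm ((f (fst p) - f (snd p)) / complex_of_real L)) \<partial>\<xi>)"
    using int by (intro integral_norm_bound_ennreal) simp
  also have "\<dots> \<le> (\<integral>\<^sup>+p. ennreal (dist (fst p) (snd p)) \<partial>\<xi>)"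
  proof (intro nn_integral_mono ennreal_leI)
    fix p :: "'a \<times> 'a"
    show "norm ((f (fst p) - f (snd p)) / complex_of_real L) \<le> dist (fst p) (snd p)"
      using lipschitz_onD[of L UNIV f "fst p" "snd p"] bl L
      by (simp add: bounded_lipschitz_def norm_divide dist_norm field_simps)
  qed
  finally show "ennreal (cmod ((\<integral>x. f x \<partial>\<mu>) - (\<integral>x. f x \<partial>\<nu>)) / L)
      \<le> (\<integral>\<^sup>+p. ennreal (dist (fst p) (snd p)) \<partial>\<xi>)" .
qed

lemma ennreal_sqrt_power2: "(ennreal_sqrt a)\<^sup>2 = a"
proof (cases "a = \<infinity>")
  case False
  then show ?thesis by (simp add: ennreal_sqrt_def ennreal_power less_top)
qed (simp add: ennreal_sqrt_def power2_eq_square)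

text \<open>Bound the variance by the mean square distance to c = f z, then average over z. The
  double integral is in fact twice the variance; the lost factor affects only constants and not the
  decay rate.\<close>

lemma (in prob_space) var_norm_square_le_nn_integral:
  assumes f: "f \<in> L2_fun M"
  shows "ennreal ((var_norm M f)\<^sup>2) \<le> (\<integral>\<^sup>+z. (\<integral>\<^sup>+y. ennreal ((cmod (f y - f z))\<^sup>2) \<partial>M) \<partial>M)"
proof -
  have "ennreal ((var_norm M f)\<^sup>2) \<le> (\<integral>\<^sup>+y. ennreal ((cmod (f y - c))\<^sup>2) \<partial>M)" for c
  proof -
    have "ennreal ((var_norm M f)\<^sup>2) \<le> ennreal ((l2_norm M (\<lambda>y. f y - c))\<^sup>2)"
      by (intro ennreal_leI power_mono var_norm_le_l2_norm_diff f) simp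
    also have "\<dots> = (\<integral>\<^sup>+y. ennreal ((cmod (f y - c))\<^sup>2) \<partial>M)"
      by (rule nn_integral_square_l2_norm[symmetric])
        (intro L2_fun_diff f L2_fun_const prob_space_axioms)
    finally show ?thesis .
  qed
  then have "(\<integral>\<^sup>+z. ennreal ((var_norm M f)\<^sup>2) \<partial>M)
      \<le> (\<integral>\<^sup>+z. (\<integral>\<^sup>+y. ennreal ((cmod (f y - f z))\<^sup>2) \<partial>M) \<partial>M)"
    by (intro nn_integral_mono)
  then show ?thesis by (simp add: emeasure_space_1)
qed

section \<open>The averaging operator and the law of total variance\<close>

locale invariant_walk =
  fixes m :: "'a::polish_space \<Rightarrow> 'a measure" and \<nu> :: "'a measure"
  assumes walk: "random_walk m" and inv: "invariant_distribution m \<nu>"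
begin

lemma kernel: "m \<in> borel \<rightarrow>\<^sub>M subprob_algebra borel"
  using walk by (auto simp: random_walk_def intro: measurable_prob_algebraD)

lemma prob_step: "prob_space (m x)" and sets_step: "sets (m x) = sets borel"
  using walk measurable_space[of m borel "prob_algebra borel" x]
  by (auto simp: random_walk_def space_prob_algebra)

lemma sets_nu: "sets \<nu> = sets borel" and bind_nu: "\<nu> \<bind> m = \<nu>"
  using inv by (auto simp: invariant_distribution_def)

lemma prob_nu: "prob_space \<nu>" using inv by (simp add: invariant_distribution_def)

sublocale nu: prob_space \<nu> by (rule prob_nu)

lemma kernel_nu: "m \<in> \<nu> \<rightarrow>\<^sub>M subprob_algebra borel"
  unfolding measurable_cong_sets[OF sets_nu refl] by (rule kernel)

lemma measurable_nu: "f \<in> borel_measurable \<nu> \<longleftrightarrow> f \<in> borel_measurable borel"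
  by (simp only: measurable_cong_sets[OF sets_nu refl])

lemma measurable_step: "f \<in> borel_measurable (m x) \<longleftrightarrow> f \<in> borel_measurable borel"
  by (simp only: measurable_cong_sets[OF sets_step refl])

lemma averaging_measurable:
  "f \<in> borel_measurable borel \<Longrightarrow> averaging m f \<in> borel_measurable borel"
  unfolding averaging_def
  by (rule measurable_compose[OF kernel integral_measurable_subprob_algebra])

lemmas averaging_L2 = averaging_L2_fun(1)[OF walk inv]

lemma averaging_power_L2: "f \<in> L2_fun \<nu> \<Longrightarrow> (averaging m ^^ n) f \<in> L2_fun \<nu>"
  by (induction n) (auto intro: averaging_L2)

lemma averaging_cmult: "averaging m (\<lambda>x. c * f x) = (\<lambda>x. c * averaging m f x)"
  by (simp add: averaging_def)

lemma averaging_add: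
  assumes "f \<in> L2_fun \<nu>" "g \<in> L2_fun \<nu>"
  shows "AE x in \<nu>. averaging m (\<lambda>x. f x + g x) x = averaging m f x + averaging m g x"
  using averaging_L2_fun(2)[OF walk inv assms(1)] averaging_L2_fun(2)[OF walk inv assms(2)]
  by eventually_elim (simp add: averaging_def)

lemma averaging_diff:
  assumes "f \<in> L2_fun \<nu>" "g \<in> L2_fun \<nu>"
  shows "AE x in \<nu>. averaging m (\<lambda>x. f x - g x) x = averaging m f x - averaging m g x"
  using averaging_add[OF assms(1) L2_fun_cmult[OF assms(2), of "-1"]]
    averaging_cmult[of "-1" g] by simp

lemma averaging_power_mod_const:
  assumes "(f, g) \<in> mod_const \<nu>"
  shows "((averaging m ^^ n) f, (averaging m ^^ n) g) \<in> mod_const \<nu>"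
  by (induction n) (auto intro: averaging_mod_const[OF walk inv] assms)

text \<open>Jensen's inequality under each \<open>m x\<close>, integrated against
  \<open>\<nu>\<close>; invariance turns the iterated integral back into one over
  \<open>\<nu>\<close>.\<close>

lemma l2_norm_averaging_le:
  assumes f: "f \<in> L2_fun \<nu>"
  shows "l2_norm \<nu> (averaging m f) \<le> l2_norm \<nu> f"
proof (rule L2_funI_nn_integral(2))
  have fm: "f \<in> borel_measurable borel" using L2_fun_measurable[OF f] by (simp add: measurable_nu)
  have [measurable]: "(\<lambda>y. ennreal ((cmod (f y))\<^sup>2)) \<in> borel_measurable borel"
    using fm by measurable
  have jensen: "ennreal ((cmod (averaging m f x))\<^sup>2) \<le> (\<integral>\<^sup>+y. ennreal ((cmod (f y))\<^sup>2) \<partial>m x)" for x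
  \<comment> \<open>Where |f|^2 is not integrable under \<open>m x\<close> the right side is
    infinite, so the inequality holds at every point without an exceptional null set.\<close>
  proof (cases "(\<integral>\<^sup>+y. ennreal ((cmod (f y))\<^sup>2) \<partial>m x) < \<infinity>")
    case True
    interpret prob_space "m x" by (rule prob_step)
    have fx: "f \<in> L2_fun (m x)"
      using True fm by (auto simp: L2_fun_def measurable_step integrable_iff_bounded)
    show ?thesis
      unfolding nn_integral_square_l2_norm[OF fx] averaging_def
      by (intro ennreal_leI power_mono norm_expectation_le_l2_norm[OF fx]) simp
  qed (auto simp: less_top[symmetric])
  have "(\<integral>\<^sup>+x. ennreal ((cmod (averaging m f x))\<^sup>2) \<partial>\<nu>)
      \<le> (\<integral>\<^sup>+x. (\<integral>\<^sup>+y. ennreal ((cmod (f y))\<^sup>2) \<partial>m x) \<partial>\<nu>)"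
    by (intro nn_integral_mono jensen)
  also have "\<dots> = (\<integral>\<^sup>+y. ennreal ((cmod (f y))\<^sup>2) \<partial>(\<nu> \<bind> m))"
    by (rule nn_integral_bind[symmetric, OF _ kernel_nu]) measurable
  also have "\<dots> = ennreal ((l2_norm \<nu> f)\<^sup>2)"
    by (simp only: bind_nu nn_integral_square_l2_norm[OF f])
  finally show "(\<integral>\<^sup>+x. ennreal ((cmod (averaging m f x))\<^sup>2) \<partial>\<nu>) \<le> ennreal ((l2_norm \<nu> f)\<^sup>2)" .
qed (use L2_fun_measurable[OF averaging_L2[OF f]] in auto)

lemma integral_step_bounded_real:
  fixes f :: "'a \<Rightarrow> real"
  assumes "f \<in> borel_measurable borel" "\<And>x. \<bar>f x\<bar> \<le> B"
  shows "(\<integral>x. (\<integral>y. f y \<partial>m x) \<partial>\<nu>) = (\<integral>x. f x \<partial>\<nu>)"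
proof -
  have "(\<integral>x. f x \<partial>(\<nu> \<bind> m)) = (\<integral>x. (\<integral>y. f y \<partial>m x) \<partial>\<nu>)"
    by (rule integral_bind[OF assms kernel_nu, where B'=1])
       (auto simp: nu.finite_measure_axioms prob_space.emeasure_space_1[OF prob_step])
  then show ?thesis by (simp add: bind_nu)
qed

lemma bounded_integrable_step:
  fixes f :: "'a \<Rightarrow> complex"
  assumes "f \<in> borel_measurable borel" "\<And>x. cmod (f x) \<le> B"
  shows "integrable (m x) f"
  by (intro L2_fun_integrable[OF prob_step] bounded_L2_fun[OF prob_step, of _ _ B])
     (use assms in \<open>simp_all add: measurable_step\<close>)

lemma averaging_bounded:
  assumes "f \<in> borel_measurable borel" "\<And>x. cmod (f x) \<le> B"
  shows "cmod (averaging m f x) \<le> B"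
proof -
  interpret prob_space "m x" by (rule prob_step)
  have "cmod (averaging m f x) \<le> (\<integral>y. cmod (f y) \<partial>m x)"
    unfolding averaging_def by (rule integral_norm_bound)
  also have "\<dots> \<le> (\<integral>y. B \<partial>m x)"
    by (intro integral_mono integrable_norm bounded_integrable_step[OF assms]) (auto intro: assms)
  finally show ?thesis by (simp add: prob_space)
qed

lemma bounded_L2_nu:
  assumes "f \<in> borel_measurable borel" "\<And>x. cmod (f x) \<le> B"
  shows "f \<in> L2_fun \<nu>"
  by (rule bounded_L2_fun[OF prob_nu]) (use assms in \<open>simp_all add: measurable_nu\<close>)

lemma integral_averaging_bounded:
  assumes f: "f \<in> borel_measurable borel" "\<And>x. cmod (f x) \<le> B"
  shows "(\<integral>x. averaging m f x \<partial>\<nu>) = (\<integral>x. f x \<partial>\<nu>)"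
proof (rule complex_eqI)
  have i: "integrable \<nu> f" "integrable \<nu> (averaging m f)"
    using bounded_L2_nu[OF f] averaging_L2 by (auto intro: nu.expectation_L2_fun)
  note ix = bounded_integrable_step[OF f]
  have "\<bar>Re (f x)\<bar> \<le> B" "\<bar>Im (f x)\<bar> \<le> B" for x
    using abs_Re_le_cmod[of "f x"] abs_Im_le_cmod[of "f x"] f(2)[of x] by linarith+
  then have *: "(\<integral>x. (\<integral>y. Re (f y) \<partial>m x) \<partial>\<nu>) = (\<integral>x. Re (f x) \<partial>\<nu>)"
    "(\<integral>x. (\<integral>y. Im (f y) \<partial>m x) \<partial>\<nu>) = (\<integral>x. Im (f x) \<partial>\<nu>)"
    using f(1) by (auto intro!: integral_step_bounded_real[where B=B])
  show "Re (\<integral>x. averaging m f x \<partial>\<nu>) = Re (\<integral>x. f x \<partial>\<nu>)"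
    using *(1) integral_Re[OF i(1)] integral_Re[OF i(2)]
    by (simp add: averaging_def integral_Re[OF ix])
  show "Im (\<integral>x. averaging m f x \<partial>\<nu>) = Im (\<integral>x. f x \<partial>\<nu>)"
    using *(2) integral_Im[OF i(1)] integral_Im[OF i(2)]
    by (simp add: averaging_def integral_Im[OF ix])
qed

text \<open>The variance under \<open>m x\<close> is M(|f|^2) - |M f|^2 at x. By invariance M(|f|^2)
  integrates to the second moment of f, and f and M f have equal means, so second moments may be
  exchanged for variances.\<close>

lemma total_variance:
  assumes f: "f \<in> borel_measurable borel" "\<And>x. cmod (f x) \<le> B"
  shows "integrable \<nu> (\<lambda>x. (var_norm (m x) f)\<^sup>2)"
    and "(var_norm \<nu> f)\<^sup>2 = (\<integral>x. (var_norm (m x) f)\<^sup>2 \<partial>\<nu>) + (var_norm \<nu> (averaging m f))\<^sup>2"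
proof -
  let ?g = "\<lambda>x. \<integral>y. (cmod (f y))\<^sup>2 \<partial>m x"
  have fx: "f \<in> L2_fun (m x)" for x
    by (rule bounded_L2_fun[OF prob_step]) (use f in \<open>simp_all add: measurable_step\<close>)
  have fn: "f \<in> L2_fun \<nu>" by (rule bounded_L2_nu[OF f])
  have local: "(var_norm (m x) f)\<^sup>2 = ?g x - (cmod (averaging m f x))\<^sup>2" for x
    using prob_space.var_norm_square[OF prob_step fx]
    by (simp add: l2_norm_square averaging_def)
  have sq: "\<bar>(cmod (f x))\<^sup>2\<bar> \<le> B\<^sup>2" for x using f(2) by (simp add: power_mono)
  have [measurable]: "(\<lambda>y. (cmod (f y))\<^sup>2) \<in> borel_measurable borel" using f(1) by measurable
  have gm: "?g \<in> borel_measurable \<nu>"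
    unfolding measurable_nu
    by (rule measurable_compose[OF kernel integral_measurable_subprob_algebra]) measurable
  have ig: "integrable \<nu> ?g"
  proof (rule nu.integrable_const_bound[where B="B\<^sup>2", OF _ gm])
    have "?g x \<le> B\<^sup>2" for x
    proof -
      interpret prob_space "m x" by (rule prob_step)
      have "?g x \<le> (\<integral>y. B\<^sup>2 \<partial>m x)"
        using sq by (intro integral_mono L2_fun_integrable_square fx) auto
      then show ?thesis by (simp add: prob_space)
    qed
    then show "AE x in \<nu>. norm (?g x) \<le> B\<^sup>2" by simp
  qed
  have ia: "integrable \<nu> (\<lambda>x. (cmod (averaging m f x))\<^sup>2)"
    by (rule L2_fun_integrable_square[OF averaging_L2[OF fn]])
  from ig ia show "integrable \<nu> (\<lambda>x. (var_norm (m x) f)\<^sup>2)" unfolding local by simp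
  have "(\<integral>x. (var_norm (m x) f)\<^sup>2 \<partial>\<nu>) = (\<integral>x. ?g x \<partial>\<nu>) - (l2_norm \<nu> (averaging m f))\<^sup>2"
    unfolding local l2_norm_square using ig ia by simp
  also have "(\<integral>x. ?g x \<partial>\<nu>) = (l2_norm \<nu> f)\<^sup>2"
    unfolding l2_norm_square by (rule integral_step_bounded_real[OF _ sq]) measurable
  finally show "(var_norm \<nu> f)\<^sup>2 = (\<integral>x. (var_norm (m x) f)\<^sup>2 \<partial>\<nu>) + (var_norm \<nu> (averaging m f))\<^sup>2"
    using nu.var_norm_square[OF fn] nu.var_norm_square[OF averaging_L2[OF fn]]
      integral_averaging_bounded[OF f] by simp
qed

end

section \<open>Contraction under positive curvature\<close>

text \<open>Log-convexity makes the ratios of successive terms nondecreasing, so \<open>a n\<close>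
  is at least q^n a(0) for the first ratio q. If q exceeded r, this would outgrow D r^n, whatever D
  is.\<close>

lemma real_sequence_log_convex:
  fixes a :: "nat \<Rightarrow> real"
  assumes nonneg: "\<And>n. 0 \<le> a n" and conv: "\<And>n. (a (Suc n))\<^sup>2 \<le> a n * a (Suc (Suc n))"
    and le: "\<And>n. a n \<le> D * r ^ n" and r: "0 \<le> r"
  shows "a 1 \<le> r * a 0"
proof (cases "a 1 = 0")
  case False
  then have a1: "0 < a 1" using nonneg[of 1] by simp
  have "(a 1)\<^sup>2 \<le> a 0 * a 2" using conv[of 0] by (simp add: numeral_2_eq_2)
  moreover have "0 < (a 1)\<^sup>2" using a1 by simp
  ultimately have a0: "0 < a 0" using nonneg[of 0] by (cases "a 0 = 0") auto
  define q where "q = a 1 / a 0"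
  have q: "0 < q" using a0 a1 by (simp add: q_def)
  \<comment> \<open>Positivity is carried through the induction because the convexity inequality is
    divided by \<open>a n\<close>.\<close>
  have step: "0 < a n \<and> q * a n \<le> a (Suc n)" for n
  proof (induction n)
    case 0
    show ?case using a0 by (simp add: q_def)
  next
    case (Suc n)
    have pos: "0 < a (Suc n)" using Suc q by (smt (verit) mult_pos_pos)
    have "a n * (q * a (Suc n)) = (q * a n) * a (Suc n)" by simp
    also have "\<dots> \<le> a (Suc n) * a (Suc n)" using Suc pos by (intro mult_right_mono) auto
    also have "\<dots> \<le> a n * a (Suc (Suc n))" using conv[of n] by (simp add: power2_eq_square)
    finally show ?case using Suc pos by simp
  qed
  have pow: "q ^ n * a 0 \<le> a n" for n
  proof (induction n)
    case (Suc n)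
    have "q ^ Suc n * a 0 = q * (q ^ n * a 0)" by simp
    also have "\<dots> \<le> q * a n" using Suc q by (intro mult_left_mono) auto
    finally show ?case using step[of n] by simp
  qed simp
  have "q \<le> r"
  proof (rule ccontr)
    assume "\<not> q \<le> r"
    then have rq: "r < q" by simp
    show False
    proof (cases "r = 0")
      case True
      then show False using le[of 1] a1 by simp
    next
      case False
      then have r0: "0 < r" using r by simp
      then have "1 < q / r" using rq by simp
      then obtain n where "D / a 0 < (q / r) ^ n" using real_arch_pow by blast
      then have "D * r ^ n < q ^ n * a 0"
        using r0 a0 by (simp add: power_divide field_simps)
      then show False using pow[of n] le[of n] by simp
    qed
  qed
  then show ?thesis using a0 by (simp add: q_def field_simps)
qed (use nonneg r in simp)

section \<open>Reversibility and self-adjointness\<close>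

context invariant_walk
begin

text \<open>With \<open>g x y\<close> equal to \<open>(x, y)\<close> or to \<open>(y, x)\<close>
  this evaluates both sides of \<open>reversible\<close>. The inner bind with \<open>return\<close>
  is a push-forward of \<open>m x\<close>.\<close>

lemma integral_joint_distribution:
  fixes F :: "'a \<times> 'a \<Rightarrow> real"
  assumes g: "(\<lambda>(x, y). g x y) \<in> borel \<Otimes>\<^sub>M borel \<rightarrow>\<^sub>M borel \<Otimes>\<^sub>M borel"
    and F[measurable]: "F \<in> borel_measurable (borel \<Otimes>\<^sub>M borel)" and FB: "\<And>p. \<bar>F p\<bar> \<le> B"
  shows "(\<integral>p. F p \<partial>(\<nu> \<bind> (\<lambda>x. m x \<bind> (\<lambda>y. return (borel \<Otimes>\<^sub>M borel) (g x y)))))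
    = (\<integral>x. (\<integral>y. F (g x y) \<partial>m x) \<partial>\<nu>)"
proof -
  have gx: "g x \<in> m x \<rightarrow>\<^sub>M borel \<Otimes>\<^sub>M borel" for x
    unfolding measurable_cong_sets[OF sets_step refl]
    using measurable_compose[OF measurable_Pair1' g, of x] by simp
  have eq: "m x \<bind> (\<lambda>y. return (borel \<Otimes>\<^sub>M borel) (g x y)) = distr (m x) (borel \<Otimes>\<^sub>M borel) (g x)" for x
    using bind_return_distr'[OF _ gx, of x] prob_space.not_empty[OF prob_step] by (simp add: comp_def)
  have K: "(\<lambda>x. distr (m x) (borel \<Otimes>\<^sub>M borel) (g x)) \<in> \<nu> \<rightarrow>\<^sub>M subprob_algebra (borel \<Otimes>\<^sub>M borel)"
    unfolding measurable_cong_sets[OF sets_nu refl]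
    by (rule measurable_distr2[OF g kernel])
  have "(\<integral>p. F p \<partial>(\<nu> \<bind> (\<lambda>x. distr (m x) (borel \<Otimes>\<^sub>M borel) (g x))))
      = (\<integral>x. (\<integral>p. F p \<partial>distr (m x) (borel \<Otimes>\<^sub>M borel) (g x)) \<partial>\<nu>)"
    by (rule integral_bind[OF F FB K nu.finite_measure_axioms, where B'=1])
      (use prob_space.emeasure_space_1[OF prob_space.prob_space_distr[OF prob_step gx]] in simp)
  also have "\<dots> = (\<integral>x. (\<integral>y. F (g x y) \<partial>m x) \<partial>\<nu>)"
    by (simp add: integral_distr[OF gx])
  finally show ?thesis by (simp only: eq)
qed

lemma reversible_integral_swap:
  fixes F :: "'a \<times> 'a \<Rightarrow> real"
  assumes rev: "reversible m \<nu>"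
    and F: "F \<in> borel_measurable (borel \<Otimes>\<^sub>M borel)" "\<And>p. \<bar>F p\<bar> \<le> B"
  shows "(\<integral>x. (\<integral>y. F (x, y) \<partial>m x) \<partial>\<nu>) = (\<integral>x. (\<integral>y. F (y, x) \<partial>m x) \<partial>\<nu>)"
  using rev integral_joint_distribution[of "\<lambda>x y. (x, y)", OF _ F]
    integral_joint_distribution[of "\<lambda>x y. (y, x)", OF _ F]
  by (simp add: reversible_def)

text \<open>Take F(x, y) = u(y) cnj(v(x)). Integrating F(x, y) over y under \<open>m x\<close> gives
  M u times cnj v, and integrating F(y, x) gives u times cnj(M v); reversibility equates the two
  total integrals. Real and imaginary parts go separately since the swap is stated for real
  functions.\<close>

lemma averaging_self_adjoint:
  assumes rev: "reversible m \<nu>"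
    and u: "u \<in> borel_measurable borel" "\<And>x. cmod (u x) \<le> B"
    and v: "v \<in> borel_measurable borel" "\<And>x. cmod (v x) \<le> C"
  shows "(\<integral>x. averaging m u x * cnj (v x) \<partial>\<nu>) = (\<integral>x. u x * cnj (averaging m v x) \<partial>\<nu>)"
proof -
  note [measurable] = u(1) v(1) averaging_measurable[OF u(1)] averaging_measurable[OF v(1)]
  have [measurable]: "cnj \<in> borel_measurable borel"
    by (intro borel_measurable_continuous_onI continuous_intros)
  have B: "0 \<le> B" using u(2) norm_ge_zero order_trans by blast
  have prod: "cmod (s * cnj t) \<le> B * C" if "cmod s \<le> B" "cmod t \<le> C" for s t
    using that B by (simp add: norm_mult mult_mono)
  define F where "F p = u (snd p) * cnj (v (fst p))" for p
  have Fm[measurable]: "F \<in> borel_measurable (borel \<Otimes>\<^sub>M borel)" unfolding F_def by measurable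
  have FB: "cmod (F p) \<le> B * C" for p unfolding F_def by (intro prod u v)
  have iF: "integrable (m x) (\<lambda>y. F (x, y))" "integrable (m x) (\<lambda>y. F (y, x))" for x
    by (rule bounded_integrable_step[where B="B * C"]; use FB in simp)+
  have L: "(\<integral>y. F (x, y) \<partial>m x) = averaging m u x * cnj (v x)" for x
    by (simp add: F_def averaging_def)
  have R: "(\<integral>y. F (y, x) \<partial>m x) = u x * cnj (averaging m v x)" for x
    by (simp add: F_def averaging_def)
  have i: "integrable \<nu> (\<lambda>x. averaging m u x * cnj (v x))" "integrable \<nu> (\<lambda>x. u x * cnj (averaging m v x))"
    by (intro nu.expectation_L2_fun bounded_L2_nu[where B="B * C"] prod averaging_bounded u v; measurable)+
  have F': "\<bar>Re (F p)\<bar> \<le> B * C" "\<bar>Im (F p)\<bar> \<le> B * C" for p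
    using abs_Re_le_cmod[of "F p"] abs_Im_le_cmod[of "F p"] FB[of p] by linarith+
  show ?thesis
  proof (rule complex_eqI)
    have "(\<integral>x. (\<integral>y. Re (F (x, y)) \<partial>m x) \<partial>\<nu>) = (\<integral>x. (\<integral>y. Re (F (y, x)) \<partial>m x) \<partial>\<nu>)"
      by (rule reversible_integral_swap[OF rev _ F'(1)]) measurable
    then show "Re (\<integral>x. averaging m u x * cnj (v x) \<partial>\<nu>) = Re (\<integral>x. u x * cnj (averaging m v x) \<partial>\<nu>)"
      unfolding integral_Re[OF iF(1)] integral_Re[OF iF(2)] L R
      unfolding integral_Re[OF i(1)] integral_Re[OF i(2)] .
    have "(\<integral>x. (\<integral>y. Im (F (x, y)) \<partial>m x) \<partial>\<nu>) = (\<integral>x. (\<integral>y. Im (F (y, x)) \<partial>m x) \<partial>\<nu>)"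
      by (rule reversible_integral_swap[OF rev _ F'(2)]) measurable
    then show "Im (\<integral>x. averaging m u x * cnj (v x) \<partial>\<nu>) = Im (\<integral>x. u x * cnj (averaging m v x) \<partial>\<nu>)"
      unfolding integral_Im[OF iF(1)] integral_Im[OF iF(2)] L R
      unfolding integral_Im[OF i(1)] integral_Im[OF i(2)] .
  qed
qed

end

section \<open>Lipschitz contraction and the Poincare inequality\<close>

locale positively_curved_walk = invariant_walk +
  fixes \<kappa> :: real
  assumes kappa: "0 < \<kappa>" "\<kappa> \<le> 1" and curvature: "ricci_at_least m \<kappa>"
    and spread_finite: "average_spread m \<nu> < \<infinity>"
begin

text \<open>The curvature bound says that the transportation distance from \<open>m x\<close> to
  \<open>m y\<close> is at most (1 - \<kappa>) d(x, y); the duality bound turns this into a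
  Lipschitz estimate for M f.\<close>

lemma averaging_bounded_lipschitz:
  assumes bl: "bounded_lipschitz L B f"
  shows "bounded_lipschitz ((1 - \<kappa>) * L) B (averaging m f)"
proof -
  have fm: "f \<in> borel_measurable borel" by (rule bounded_lipschitz_measurable[OF bl])
  have lip: "L-lipschitz_on UNIV f" and fB: "\<And>x. cmod (f x) \<le> B"
    using bl by (auto simp: bounded_lipschitz_def)
  have L: "0 \<le> L" using lip by (rule lipschitz_on_nonneg)
  have "dist (averaging m f x) (averaging m f y) \<le> (1 - \<kappa>) * L * dist x y" for x y
  \<comment> \<open>The duality bound divides by L and the curvature by d(x, y). For L = 0 the
    function is constant, and averaging fixes constants.\<close>
  proof (cases "L = 0 \<or> x = y")
    case True
    then consider "x = y" | "L = 0" by blast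
    then show ?thesis
    proof cases
      case 2
      have "f = (\<lambda>_. f x)"
        using lipschitz_onD[OF lip, of _ x] 2 by auto
      then have "averaging m f = averaging m (\<lambda>_. f x)" by simp
      moreover have "averaging m (\<lambda>_. c) z = c" for z c
        by (simp add: averaging_def prob_space.prob_space[OF prob_step])
      ultimately show ?thesis using 2 by simp
    qed simp
  next
    case False
    then have L0: "0 < L" and xy: "x \<noteq> y" using L by auto
    let ?T = "transport_dist (m x) (m y)"
    obtain z w where mom: "integrable (m x) (dist z)" "integrable (m y) (dist w)"
      using walk unfolding random_walk_def by meson
    have fin: "?T < \<infinity>"
      using mom by (rule transport_dist_finite[OF prob_step prob_step sets_step sets_step])
    have "1 - enn2real ?T / dist x y \<ge> \<kappa>"
      using curvature xy by (simp add: ricci_at_least_def ricci_def)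
    then have T: "enn2real ?T \<le> (1 - \<kappa>) * dist x y"
      using xy by (simp add: field_simps)
    have "ennreal (dist (averaging m f x) (averaging m f y) / L) \<le> ?T"
      unfolding dist_norm averaging_def
      by (rule lipschitz_integral_transport_dist[OF prob_step bl L0])
    from enn2real_mono[OF this] fin L0
    have "dist (averaging m f x) (averaging m f y) / L \<le> enn2real ?T" by simp
    also note T
    finally show ?thesis using L0 by (simp add: field_simps)
  qed
  moreover have "0 \<le> (1 - \<kappa>) * L" using kappa L by simp
  ultimately show ?thesis
    using averaging_bounded[OF fm fB] by (auto simp: bounded_lipschitz_def intro!: lipschitz_onI)
qed

lemma averaging_power_bounded_lipschitz:
  assumes bl: "bounded_lipschitz L B f"
  shows "bounded_lipschitz ((1 - \<kappa>) ^ n * L) B ((averaging m ^^ n) f)"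
  by (induction n) (use bl averaging_bounded_lipschitz in \<open>auto simp: mult.assoc\<close>)

text \<open>Twice the square of the average spread: the factor 1/2 of \<open>spread\<close> is left
  out. The integral is finite by \<open>nn_integral_spread\<close>, so \<open>enn2real\<close> loses
  nothing.\<close>

definition total_spread :: real where
  "total_spread = enn2real (\<integral>\<^sup>+x. (\<integral>\<^sup>+z. (\<integral>\<^sup>+y. ennreal ((dist y z)\<^sup>2) \<partial>m x) \<partial>m x) \<partial>\<nu>)"

lemma spread_measurable:
  "(\<lambda>x. \<integral>\<^sup>+z. (\<integral>\<^sup>+y. ennreal ((dist y z)\<^sup>2) \<partial>m x) \<partial>m x) \<in> borel_measurable borel"
proof (rule nn_integral_measurable_subprob_algebra2[OF _ kernel])
  have "(\<lambda>p. \<integral>\<^sup>+y. ennreal ((dist y (snd p))\<^sup>2) \<partial>m (fst p)) \<in> borel_measurable (borel \<Otimes>\<^sub>M borel)"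
    by (rule nn_integral_measurable_subprob_algebra2[OF _ measurable_compose[OF measurable_fst kernel]])
      measurable
  then show "(\<lambda>(x, z). \<integral>\<^sup>+y. ennreal ((dist y z)\<^sup>2) \<partial>m x) \<in> borel_measurable (borel \<Otimes>\<^sub>M borel)"
    by (simp add: case_prod_beta)
qed

lemma nn_integral_spread:
  "(\<integral>\<^sup>+x. (\<integral>\<^sup>+z. (\<integral>\<^sup>+y. ennreal ((dist y z)\<^sup>2) \<partial>m x) \<partial>m x) \<partial>\<nu>) = ennreal total_spread"
proof -
  let ?J = "\<lambda>x. \<integral>\<^sup>+z. (\<integral>\<^sup>+y. ennreal ((dist y z)\<^sup>2) \<partial>m x) \<partial>m x"
  have Jm: "?J \<in> borel_measurable \<nu>" using spread_measurable by (simp add: measurable_nu)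
  have "(\<integral>\<^sup>+x. ?J x \<partial>\<nu>) / 2 = (\<integral>\<^sup>+x. ?J x / 2 \<partial>\<nu>)"
    by (rule nn_integral_divide[OF Jm, symmetric])
  also have "\<dots> = (average_spread m \<nu>)\<^sup>2"
    by (simp add: average_spread_def spread_def ennreal_sqrt_power2)
  also have "\<dots> < \<infinity>"
    using spread_finite by (simp add: power2_eq_square ennreal_mult_less_top)
  finally have "(\<integral>\<^sup>+x. ?J x \<partial>\<nu>) / 2 < \<infinity>" .
  then have "(\<integral>\<^sup>+x. ?J x \<partial>\<nu>) < \<infinity>"
    by (simp add: divide_less_ennreal ennreal_mult_less_top ennreal_divide_eq_top_iff flip: less_top)
  then show ?thesis by (simp add: total_spread_def)
qed

text \<open>Under \<open>m x\<close> the Lipschitz bound compares |f(y) - f(z)|^2 with L^2 d(y,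
  z)^2, whose double integral is the local spread up to a factor.\<close>

lemma local_variance_bound:
  assumes bl: "bounded_lipschitz L B f"
  shows "(\<integral>x. (var_norm (m x) f)\<^sup>2 \<partial>\<nu>) \<le> L\<^sup>2 * total_spread"
proof -
  let ?J = "\<lambda>x. \<integral>\<^sup>+z. (\<integral>\<^sup>+y. ennreal ((dist y z)\<^sup>2) \<partial>m x) \<partial>m x"
  have fm: "f \<in> borel_measurable borel" by (rule bounded_lipschitz_measurable[OF bl])
  have lip: "L-lipschitz_on UNIV f" and fB: "\<And>x. cmod (f x) \<le> B"
    using bl by (auto simp: bounded_lipschitz_def)
  have loc: "ennreal ((var_norm (m x) f)\<^sup>2) \<le> ennreal (L\<^sup>2) * ?J x" for x
  proof -
    note [measurable_cong] = sets_step[of x]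
    interpret prob_space "m x" by (rule prob_step)
    have "ennreal ((var_norm (m x) f)\<^sup>2) \<le> (\<integral>\<^sup>+z. (\<integral>\<^sup>+y. ennreal ((cmod (f y - f z))\<^sup>2) \<partial>m x) \<partial>m x)"
      by (rule var_norm_square_le_nn_integral)
        (rule bounded_lipschitz_L2_fun[OF prob_step sets_step bl])
    also have "\<dots> \<le> (\<integral>\<^sup>+z. (\<integral>\<^sup>+y. ennreal (L\<^sup>2) * ennreal ((dist y z)\<^sup>2) \<partial>m x) \<partial>m x)"
    proof (intro nn_integral_mono)
      fix y z :: 'a
      have "cmod (f y - f z) \<le> L * dist y z"
        using lipschitz_onD[OF lip, of y z] by (simp add: dist_norm)
      from power_mono[OF this, of 2]
      show "ennreal ((cmod (f y - f z))\<^sup>2) \<le> ennreal (L\<^sup>2) * ennreal ((dist y z)\<^sup>2)"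
        by (simp add: power_mult_distrib ennreal_leI flip: ennreal_mult)
    qed
    also have "\<dots> = (\<integral>\<^sup>+z. ennreal (L\<^sup>2) * (\<integral>\<^sup>+y. ennreal ((dist y z)\<^sup>2) \<partial>m x) \<partial>m x)"
      by (intro nn_integral_cong nn_integral_cmult) measurable
    also have "\<dots> = ennreal (L\<^sup>2) * ?J x"
      by (intro nn_integral_cmult) measurable
    finally show ?thesis .
  qed
  have "(\<integral>\<^sup>+x. ennreal ((var_norm (m x) f)\<^sup>2) \<partial>\<nu>) \<le> (\<integral>\<^sup>+x. ennreal (L\<^sup>2) * ?J x \<partial>\<nu>)"
    by (intro nn_integral_mono loc)
  also have "\<dots> = ennreal (L\<^sup>2) * ennreal total_spread"
    unfolding nn_integral_spread[symmetric]
    by (rule nn_integral_cmult) (use spread_measurable in \<open>simp add: measurable_nu\<close>)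
  finally have "ennreal (\<integral>x. (var_norm (m x) f)\<^sup>2 \<partial>\<nu>) \<le> ennreal (L\<^sup>2 * total_spread)"
    using total_variance(1)[OF fm fB]
    by (simp add: nn_integral_eq_integral ennreal_mult total_spread_def)
  then show ?thesis by (simp add: total_spread_def)
qed

text \<open>The sum of the geometric series with first term \<open>total_spread\<close> and ratio (1
  - \<kappa>)^2. It bounds the local variances collected along f, M f, M^2 f, ... for a 1-Lipschitz
  f.\<close>

definition poincare_const :: real where
  "poincare_const = total_spread / (1 - (1 - \<kappa>)\<^sup>2)"

lemma poincare_const: "0 \<le> poincare_const" "total_spread + (1 - \<kappa>)\<^sup>2 * poincare_const = poincare_const"
proof -
  have "(1 - \<kappa>)\<^sup>2 \<le> 1 - \<kappa>" using kappa by (simp add: power2_eq_square mult_left_le)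
  then have "(1 - \<kappa>)\<^sup>2 < 1" using kappa by simp
  then show "0 \<le> poincare_const" "total_spread + (1 - \<kappa>)\<^sup>2 * poincare_const = poincare_const"
    by (simp_all add: poincare_const_def total_spread_def field_simps)
qed

text \<open>The induction step applies total variance once and passes to M f, whose Lipschitz
  constant has shrunk by 1 - \<kappa>. The fixed-point equation of \<open>poincare_const\<close>
  keeps the constant the same for all n.\<close>

lemma variance_telescope:
  assumes "bounded_lipschitz L B f"
  shows "(var_norm \<nu> f)\<^sup>2 \<le> L\<^sup>2 * poincare_const + (var_norm \<nu> ((averaging m ^^ n) f))\<^sup>2"
  using assms
proof (induction n arbitrary: L f)
  case (Suc n)
  have fm: "f \<in> borel_measurable borel" by (rule bounded_lipschitz_measurable[OF Suc.prems])
  have fB: "\<And>x. cmod (f x) \<le> B" using Suc.prems by (auto simp: bounded_lipschitz_def)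
  have "(var_norm \<nu> f)\<^sup>2 \<le> L\<^sup>2 * total_spread + (var_norm \<nu> (averaging m f))\<^sup>2"
    using total_variance(2)[OF fm fB] local_variance_bound[OF Suc.prems] by simp
  also have "(var_norm \<nu> (averaging m f))\<^sup>2 \<le> ((1 - \<kappa>) * L)\<^sup>2 * poincare_const
      + (var_norm \<nu> ((averaging m ^^ n) (averaging m f)))\<^sup>2"
    by (rule Suc.IH[OF averaging_bounded_lipschitz[OF Suc.prems]])
  also have "L\<^sup>2 * total_spread + (((1 - \<kappa>) * L)\<^sup>2 * poincare_const
      + (var_norm \<nu> ((averaging m ^^ n) (averaging m f)))\<^sup>2)
    = L\<^sup>2 * (total_spread + (1 - \<kappa>)\<^sup>2 * poincare_const) + (var_norm \<nu> ((averaging m ^^ Suc n) f))\<^sup>2"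
    by (simp only: power_mult_distrib funpow_Suc_right o_apply) (simp add: algebra_simps)
  finally show ?case by (simp only: poincare_const(2))
qed (simp add: poincare_const(1))

text \<open>The iterates become flat: at each x they approach their value at a base point, and the
  common bound \<open>B\<close> gives domination. This gives no rate, as distances may be unbounded,
  but it removes the remainder in \<open>variance_telescope\<close>.\<close>

lemma var_norm_averaging_power_tendsto_0:
  assumes bl: "bounded_lipschitz L B f"
  shows "(\<lambda>n. var_norm \<nu> ((averaging m ^^ n) f)) \<longlonglongrightarrow> 0"
proof -
  define g where "g n = (averaging m ^^ n) f" for n
  have gbl: "bounded_lipschitz ((1 - \<kappa>) ^ n * L) B (g n)" for n
    unfolding g_def by (rule averaging_power_bounded_lipschitz[OF bl])
  have gL2: "g n \<in> L2_fun \<nu>" for n by (rule bounded_lipschitz_L2_fun[OF prob_nu sets_nu gbl])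
  have gB: "cmod (g n x) \<le> B" for n x using gbl by (simp add: bounded_lipschitz_def)
  define x0 :: 'a where "x0 = undefined"
  have [measurable]: "g n \<in> borel_measurable \<nu>" for n by (rule L2_fun_measurable[OF gL2])
  have "(\<lambda>n. l2_norm \<nu> (\<lambda>x. 0 - (g n x - g n x0))) \<longlonglongrightarrow> 0"
  proof (rule l2_norm_dominated_convergence[OF prob_nu sets_nu])
    show "integrable \<nu> (\<lambda>x. (2 * B)\<^sup>2)" by simp
    show "(cmod (0 - (g n x - g n x0)))\<^sup>2 \<le> (2 * B)\<^sup>2" for n x
      using norm_triangle_ineq4[of "g n x" "g n x0"] gB[of n x] gB[of n x0]
      by (intro power_mono) (auto simp: norm_minus_commute)
    show "(\<lambda>n. g n x - g n x0) \<longlonglongrightarrow> 0" for x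
    proof (rule Lim_null_comparison)
      have "cmod (g n x - g n x0) \<le> (1 - \<kappa>) ^ n * (L * dist x x0)" for n
        using lipschitz_onD[of "(1 - \<kappa>) ^ n * L" UNIV "g n" x x0] gbl[of n]
        by (simp add: bounded_lipschitz_def dist_norm mult.assoc)
      then show "\<forall>\<^sub>F n in sequentially. cmod (g n x - g n x0) \<le> (1 - \<kappa>) ^ n * (L * dist x x0)"
        by simp
      show "(\<lambda>n. (1 - \<kappa>) ^ n * (L * dist x x0)) \<longlonglongrightarrow> 0"
        using kappa by (intro tendsto_mult_left_zero LIMSEQ_power_zero) simp
    qed
  qed measurable
  moreover have "l2_norm \<nu> (\<lambda>x. 0 - (g n x - g n x0)) = l2_norm \<nu> (\<lambda>x. g n x - g n x0)" for n
    by (simp add: l2_norm_def norm_minus_commute)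
  ultimately have lim: "(\<lambda>n. l2_norm \<nu> (\<lambda>x. g n x - g n x0)) \<longlonglongrightarrow> 0" by simp
  show ?thesis
    unfolding g_def[symmetric]
    by (rule tendsto_sandwich[OF _ _ tendsto_const lim])
      (auto intro!: always_eventually nu.var_norm_le_l2_norm_diff gL2)
qed

text \<open>Let n tend to infinity in \<open>variance_telescope\<close>. Applied to M^n f, which is
  (1 - \<kappa>)^n L-Lipschitz, the inequality then gives geometric decay.\<close>

lemma poincare_inequality:
  assumes bl: "bounded_lipschitz L B f"
  shows "var_norm \<nu> f \<le> L * sqrt poincare_const"
proof (rule power2_le_imp_le)
  have "(\<lambda>n. L\<^sup>2 * poincare_const + (var_norm \<nu> ((averaging m ^^ n) f))\<^sup>2)
      \<longlonglongrightarrow> L\<^sup>2 * poincare_const + 0\<^sup>2"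
    by (intro tendsto_intros var_norm_averaging_power_tendsto_0[OF bl])
  then have "(var_norm \<nu> f)\<^sup>2 \<le> L\<^sup>2 * poincare_const + 0\<^sup>2"
    by (rule LIMSEQ_le_const) (use variance_telescope[OF bl] in blast)
  then show "(var_norm \<nu> f)\<^sup>2 \<le> (L * sqrt poincare_const)\<^sup>2"
    by (simp add: power_mult_distrib poincare_const(1))
  show "0 \<le> L * sqrt poincare_const"
    using bl lipschitz_on_nonneg[of L UNIV f] poincare_const(1) by (simp add: bounded_lipschitz_def)
qed

lemma var_norm_averaging_power_lipschitz:
  assumes bl: "bounded_lipschitz L B f"
  shows "var_norm \<nu> ((averaging m ^^ n) f) \<le> L * sqrt poincare_const * (1 - \<kappa>) ^ n"
  using poincare_inequality[OF averaging_power_bounded_lipschitz[OF bl, of n]]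
  by (simp add: mult_ac)

section \<open>The reversible case\<close>

lemma averaging_contraction_extend:
  assumes lip: "\<And>L B f. bounded_lipschitz L B f \<Longrightarrow>
      var_norm \<nu> (averaging m f) \<le> (1 - \<kappa>) * var_norm \<nu> f"
    and f: "f \<in> L2_fun \<nu>"
  shows "var_norm \<nu> (averaging m f) \<le> (1 - \<kappa>) * var_norm \<nu> f"
proof (rule field_le_epsilon)
  fix e :: real assume "0 < e"
  then have "0 < e / 2" by simp
  then obtain L B h where h: "bounded_lipschitz L B h" "l2_norm \<nu> (\<lambda>x. f x - h x) < e / 2"
    using L2_lipschitz_approximable[OF prob_nu sets_nu f]
    unfolding lipschitz_approximable_def by meson
  \<comment> \<open>M does not increase the L2 norm, so the errors \<open>u\<close> and
    \<open>averaging m u\<close> both have variance seminorm at most \<open>e / 2\<close>.\<close>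
  define u where "u x = f x - h x" for x
  have hL2: "h \<in> L2_fun \<nu>" by (rule bounded_lipschitz_L2_fun[OF prob_nu sets_nu h(1)])
  have uL2: "u \<in> L2_fun \<nu>" unfolding u_def by (rule L2_fun_diff[OF f hL2])
  have u: "var_norm \<nu> u \<le> e / 2" "var_norm \<nu> (averaging m u) \<le> e / 2"
    using nu.var_norm_le_l2_norm[OF uL2] nu.var_norm_le_l2_norm[OF averaging_L2[OF uL2]]
      l2_norm_averaging_le[OF uL2] h(2) unfolding u_def by linarith+
  have "(averaging m f, \<lambda>x. averaging m h x + averaging m u x) \<in> mod_const \<nu>"
  proof -
    have "AE x in \<nu>. averaging m f x = averaging m h x + averaging m u x + 0"
      using averaging_add[OF hL2 uL2] by (simp add: u_def)
    then show ?thesis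
      unfolding mod_const_def using averaging_L2 f hL2 uL2 L2_fun_add by blast
  qed
  then have "var_norm \<nu> (averaging m f) = var_norm \<nu> (\<lambda>x. averaging m h x + averaging m u x)"
    by (rule var_norm_cong[OF prob_nu])
  also have "\<dots> \<le> var_norm \<nu> (averaging m h) + var_norm \<nu> (averaging m u)"
    by (intro nu.var_norm_triangle averaging_L2 hL2 uL2)
  also have "\<dots> \<le> (1 - \<kappa>) * var_norm \<nu> h + e / 2"
    using lip[OF h(1)] u(2) by simp
  also have "var_norm \<nu> h = var_norm \<nu> (\<lambda>x. f x - u x)" by (simp add: u_def)
  also have "\<dots> \<le> var_norm \<nu> f + var_norm \<nu> u" by (rule nu.var_norm_triangle_diff[OF f uL2])
  also have "(1 - \<kappa>) * (var_norm \<nu> f + var_norm \<nu> u) + e / 2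
      \<le> (1 - \<kappa>) * var_norm \<nu> f + 1 * (e / 2) + e / 2"
    unfolding distrib_left using kappa u(1)
    by (intro add_mono mult_mono order_refl) auto
  finally show "var_norm \<nu> (averaging m f) \<le> (1 - \<kappa>) * var_norm \<nu> f + e"
    using kappa by (simp add: mult_left_mono)
qed

text \<open>For the centred orbit g n, self-adjointness gives ||g(n+1)||^2 = <g(n), g(n+2)>, and
  Cauchy-Schwarz makes the norms log-convex. Their decay rate therefore bounds the first ratio, and
  the constant depending on L disappears.\<close>

lemma reversible_contraction_lipschitz:
  assumes rev: "reversible m \<nu>" and bl: "bounded_lipschitz L B f"
  shows "var_norm \<nu> (averaging m f) \<le> (1 - \<kappa>) * var_norm \<nu> f"
proof -
  define c where "c = (\<integral>x. f x \<partial>\<nu>)"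
  \<comment> \<open>Averaging preserves the mean, so after centring every iterate has mean 0 and
    \<open>var_norm\<close> agrees with \<open>l2_norm\<close> along the orbit.\<close>
  define g where "g n = (averaging m ^^ n) (\<lambda>x. f x + (- c))" for n
  have gbl: "bounded_lipschitz ((1 - \<kappa>) ^ n * (L + 0)) (B + cmod (- c)) (g n)" for n
    unfolding g_def
    by (intro averaging_power_bounded_lipschitz bounded_lipschitz_add bl bounded_lipschitz_const)
  have gm: "g n \<in> borel_measurable borel" for n by (rule bounded_lipschitz_measurable[OF gbl])
  have gB: "cmod (g n x) \<le> B + cmod (- c)" for n x
    using gbl by (simp add: bounded_lipschitz_def)
  have gL2: "g n \<in> L2_fun \<nu>" for n by (rule bounded_L2_nu[OF gm gB])
  have g_Suc: "g (Suc n) = averaging m (g n)" for n by (simp add: g_def)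
  have fL2: "f \<in> L2_fun \<nu>" by (rule bounded_lipschitz_L2_fun[OF prob_nu sets_nu bl])
  have mean: "(\<integral>x. g n x \<partial>\<nu>) = 0" for n
  proof (induction n)
    case 0
    show ?case using nu.expectation_L2_fun[OF fL2] by (simp add: g_def c_def nu.prob_space)
  next
    case (Suc n)
    then show ?case by (simp add: g_Suc integral_averaging_bounded[OF gm gB])
  qed
  have norm: "var_norm \<nu> (g n) = l2_norm \<nu> (g n)" for n
    by (simp add: nu.var_norm_eq_l2_norm mean)
  have "l2_norm \<nu> (g 1) \<le> (1 - \<kappa>) * l2_norm \<nu> (g 0)"
  proof (rule real_sequence_log_convex)
    show "l2_norm \<nu> (g n) \<le> ((L + 0) * sqrt poincare_const) * (1 - \<kappa>) ^ n" for n
      unfolding norm[symmetric] unfolding g_def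
      by (rule var_norm_averaging_power_lipschitz[OF
            bounded_lipschitz_add[OF bl bounded_lipschitz_const]])
    show "(l2_norm \<nu> (g (Suc n)))\<^sup>2 \<le> l2_norm \<nu> (g n) * l2_norm \<nu> (g (Suc (Suc n)))" for n
    proof -
      have "complex_of_real ((l2_norm \<nu> (g (Suc n)))\<^sup>2) = (\<integral>x. g (Suc n) x * cnj (g (Suc n) x) \<partial>\<nu>)"
        by (simp only: l2_norm_square complex_norm_square flip: integral_complex_of_real)
      also have "\<dots> = (\<integral>x. averaging m (g n) x * cnj (g (Suc n) x) \<partial>\<nu>)" by (simp add: g_Suc)
      also have "\<dots> = (\<integral>x. g n x * cnj (averaging m (g (Suc n)) x) \<partial>\<nu>)"
        by (rule averaging_self_adjoint[OF rev gm gB gm gB])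
      also have "\<dots> = (\<integral>x. g n x * cnj (g (Suc (Suc n)) x) \<partial>\<nu>)" by (simp add: g_Suc)
      finally have "(l2_norm \<nu> (g (Suc n)))\<^sup>2 = cmod (\<integral>x. g n x * cnj (g (Suc (Suc n)) x) \<partial>\<nu>)"
        by (metis abs_power2 norm_of_real)
      then show ?thesis using l2_norm_Cauchy_Schwarz[OF gL2 gL2] by simp
    qed
  qed (use kappa in simp_all)
  then have *: "var_norm \<nu> (g 1) \<le> (1 - \<kappa>) * var_norm \<nu> (g 0)" by (simp add: norm)
  have 0: "(f, g 0) \<in> mod_const \<nu>"
  proof -
    have "AE x in \<nu>. f x = g 0 x + c" by (simp add: g_def)
    then show ?thesis unfolding mod_const_def using fL2 gL2 by blast
  qed
  then have "(averaging m f, g 1) \<in> mod_const \<nu>"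
    using averaging_mod_const[OF walk inv] g_Suc[of 0] by simp
  with 0 * show ?thesis using var_norm_cong[OF prob_nu] by metis
qed

lemma reversible_power_bound:
  assumes rev: "reversible m \<nu>" and f: "f \<in> L2_fun \<nu>"
  shows "var_norm \<nu> ((averaging m ^^ n) f) \<le> (1 - \<kappa>) ^ n * var_norm \<nu> f"
proof (induction n)
  case (Suc n)
  have "var_norm \<nu> ((averaging m ^^ Suc n) f) \<le> (1 - \<kappa>) * var_norm \<nu> ((averaging m ^^ n) f)"
    using averaging_contraction_extend[OF reversible_contraction_lipschitz[OF rev] averaging_power_L2[OF f]]
    by simp
  also have "\<dots> \<le> (1 - \<kappa>) * ((1 - \<kappa>) ^ n * var_norm \<nu> f)"
    using kappa Suc by (intro mult_left_mono) auto
  finally show ?case by (simp add: mult.assoc)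
qed simp

section \<open>The finite case\<close>

lemma finite_power_bound:
  assumes fin: "finite (UNIV :: 'a set)"
  shows "\<exists>C\<ge>0. \<forall>n. \<forall>f\<in>L2_fun \<nu>. var_norm \<nu> ((averaging m ^^ n) f) \<le> C * (1 - \<kappa>) ^ n * var_norm \<nu> f"
proof -
  have sets_all: "A \<in> sets \<nu>" for A
    using finite_subset[OF subset_UNIV fin, of A] by (simp add: sets_nu borel_closed finite_imp_closed)
  \<comment> \<open>\<open>\<delta>\<close> is a positive lower bound for the distances of distinct
    points and \<open>p\<close> one for the positive probabilities. The inserted 1 keeps the first
    minimum defined on a one-point space.\<close>
  define \<delta> where "\<delta> = Min (insert 1 ((\<lambda>p. dist (fst p) (snd p)) ` {p :: 'a \<times> 'a. fst p \<noteq> snd p}))"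
  define p where "p = Min (insert 1 (nu.prob ` {S. nu.prob S > 0}))"
  have fin_dist: "finite ((\<lambda>p. dist (fst p) (snd p)) ` {p :: 'a \<times> 'a. fst p \<noteq> snd p})"
    by (rule finite_imageI, rule finite_subset[OF subset_UNIV]) (simp add: finite_Prod_UNIV fin)
  then have \<delta>_pos: "0 < \<delta>" unfolding \<delta>_def by auto
  have \<delta>_le: "\<delta> \<le> dist x y" if "x \<noteq> y" for x y :: 'a
    unfolding \<delta>_def
    using imageI[of "(x, y)" "{p. fst p \<noteq> snd p}" "\<lambda>p. dist (fst p) (snd p)"] that fin_dist
    by (intro Min_le) simp_all
  have "finite (nu.prob ` {S. nu.prob S > 0})"
    by (rule finite_imageI, rule finite_subset[OF subset_UNIV]) (simp add: Finite_Set.finite_set fin)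
  then have p: "0 < p" "\<And>S. nu.prob S > 0 \<Longrightarrow> p \<le> nu.prob S"
    unfolding p_def by (auto intro!: Min_le)
  \<comment> \<open>The factor 2 / (sqrt p * \<delta>) is the Lipschitz constant per unit of
    \<open>var_norm\<close>; the other factor comes from the Poincare inequality.\<close>
  define C where "C = 2 / (sqrt p * \<delta>) * sqrt poincare_const"
  have "var_norm \<nu> ((averaging m ^^ n) f) \<le> C * (1 - \<kappa>) ^ n * var_norm \<nu> f" if f: "f \<in> L2_fun \<nu>" for n f
  proof -
    define c where "c = (\<integral>x. f x \<partial>\<nu>)"
    define V where "V = var_norm \<nu> f"
    \<comment> \<open>The seminorm does not see the values of f at points of measure zero, but the
      Lipschitz constant does. There f is replaced by its mean, which stays in the same
      class.\<close>
    define g where "g x = (if nu.prob {x} > 0 then f x else c)" for x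
    have V0: "0 \<le> V" by (simp add: V_def)
    \<comment> \<open>A point of positive mass has mass at least p and so contributes at least p
      |f(x) - c|^2 to the variance.\<close>
    have dev: "cmod (g x - c) \<le> V / sqrt p" for x
    proof (cases "nu.prob {x} > 0")
      case True
      have "p * (cmod (f x - c))\<^sup>2 \<le> nu.prob {x} * (cmod (f x - c))\<^sup>2"
        using p(2)[OF True] by (intro mult_right_mono) auto
      also have "\<dots> = (\<integral>y. indicator {x} y * (cmod (f x - c))\<^sup>2 \<partial>\<nu>)"
        using sets_all by simp
      also have "\<dots> \<le> (\<integral>y. (cmod (f y - c))\<^sup>2 \<partial>\<nu>)"
        using L2_fun_integrable_square[OF nu.L2_fun_center[OF f]]
        by (intro integral_mono') (auto simp: c_def indicator_def)
      also have "\<dots> = V\<^sup>2" by (simp add: V_def var_norm_def c_def)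
      finally have "(sqrt p * cmod (f x - c))\<^sup>2 \<le> V\<^sup>2"
        using p(1) by (simp add: power_mult_distrib)
      then have "sqrt p * cmod (f x - c) \<le> V" using V0 by (rule power2_le_imp_le)
      then show ?thesis using p(1) True by (simp add: g_def field_simps)
    qed (use V0 p(1) in \<open>simp add: g_def\<close>)
    \<comment> \<open>Two values differ by at most 2 V / sqrt p, and distinct points are at least
      \<open>\<delta>\<close> apart.\<close>
    define L where "L = 2 * V / (sqrt p * \<delta>)"
    have L0: "0 \<le> L" using V0 p(1) \<delta>_pos by (simp add: L_def)
    have "dist (g x) (g y) \<le> L * dist x y" for x y
    proof (cases "x = y")
      case False
      have "dist (g x) (g y) \<le> cmod (g x - c) + cmod (g y - c)"
        using norm_triangle_ineq4[of "g x - c" "g y - c"] by (simp add: dist_norm)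
      also have "\<dots> \<le> V / sqrt p + V / sqrt p" by (intro add_mono dev)
      also have "\<dots> = L * \<delta>" using \<delta>_pos by (simp add: L_def)
      also have "\<dots> \<le> L * dist x y" using L0 \<delta>_le[OF False] by (intro mult_left_mono)
      finally show ?thesis .
    qed simp
    moreover have "cmod (g x) \<le> Max (range (\<lambda>x. cmod (g x)))" for x
      using fin by (intro Max_ge) auto
    ultimately have bl: "bounded_lipschitz L (Max (range (\<lambda>x. cmod (g x)))) g"
      using L0 by (auto simp: bounded_lipschitz_def intro!: lipschitz_onI)
    have "AE x in \<nu>. f x = g x + 0"
    proof (rule AE_I')
      show "(\<Union>x\<in>{x. nu.prob {x} = 0}. {x}) \<in> null_sets \<nu>"
        using sets_all finite_subset[OF subset_UNIV fin]
        by (intro null_sets_UN' countable_finite) (auto simp: nu.emeasure_eq_measure)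
      show "{x \<in> space \<nu>. f x \<noteq> g x + 0} \<subseteq> (\<Union>x\<in>{x. nu.prob {x} = 0}. {x})"
        by (auto simp: g_def zero_less_measure_iff split: if_splits)
    qed
    then have "(f, g) \<in> mod_const \<nu>"
      unfolding mod_const_def using f bounded_lipschitz_L2_fun[OF prob_nu sets_nu bl] by blast
    from averaging_power_mod_const[OF this]
    have "var_norm \<nu> ((averaging m ^^ n) f) = var_norm \<nu> ((averaging m ^^ n) g)"
      by (rule var_norm_cong[OF prob_nu])
    also have "\<dots> \<le> L * sqrt poincare_const * (1 - \<kappa>) ^ n"
      by (rule var_norm_averaging_power_lipschitz[OF bl])
    also have "\<dots> = C * (1 - \<kappa>) ^ n * V" by (simp add: L_def C_def)
    finally show ?thesis by (simp add: V_def)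
  qed
  moreover have "0 \<le> C" using p(1) \<delta>_pos poincare_const(1) by (simp add: C_def)
  ultimately show ?thesis by blast
qed

end

section \<open>The spectrum\<close>

text \<open>Equality of classes becomes the vanishing of a seminorm, so it can be proved by norm
  estimates and limits.\<close>

lemma (in prob_space) mod_const_iff_var_norm:
  "(f, g) \<in> mod_const M \<longleftrightarrow>
    f \<in> L2_fun M \<and> g \<in> L2_fun M \<and> var_norm M (\<lambda>x. f x - g x) = 0"
proof (intro iffI conjI)
  assume fg: "(f, g) \<in> mod_const M"
  then show L2: "f \<in> L2_fun M" "g \<in> L2_fun M" by (auto simp: mod_const_def)
  obtain c where "AE x in M. f x = g x + c" using fg by (auto simp: mod_const_def)
  then have "AE x in M. f x - g x = 0 + c" by eventually_elim simp
  then have "(\<lambda>x. f x - g x, \<lambda>x. 0) \<in> mod_const M"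
    unfolding mod_const_def using L2_fun_diff[OF L2] L2_fun_const[OF prob_space_axioms] by blast
  from var_norm_cong[OF prob_space_axioms this] show "var_norm M (\<lambda>x. f x - g x) = 0"
    by (simp add: var_norm_def)
next
  assume *: "f \<in> L2_fun M \<and> g \<in> L2_fun M \<and> var_norm M (\<lambda>x. f x - g x) = 0"
  then have "AE x in M. f x - g x = expectation (\<lambda>x. f x - g x)"
    by (intro var_norm_eq_0D L2_fun_diff) auto
  then have "AE x in M. f x = g x + expectation (\<lambda>x. f x - g x)"
    by eventually_elim (simp add: algebra_simps)
  with * show "(f, g) \<in> mod_const M" unfolding mod_const_def by blast
qed

section \<open>The operator z - M on functions and on classes\<close>

context invariant_walk
begin

definition shift :: "complex \<Rightarrow> ('a \<Rightarrow> complex) \<Rightarrow> 'a \<Rightarrow> complex" where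
  "shift z f = (\<lambda>x. z * f x - averaging m f x)"

lemma shift_L2: "f \<in> L2_fun \<nu> \<Longrightarrow> shift z f \<in> L2_fun \<nu>"
  unfolding shift_def by (rule quot_map_shift_class(1)[OF walk inv])

lemma quot_map_shift:
  "f \<in> L2_fun \<nu> \<Longrightarrow>
    quot_map \<nu> (\<lambda>f x. z * f x - averaging m f x) (mod_const \<nu> `` {f}) = mod_const \<nu> `` {shift z f}"
  unfolding shift_def by (rule quot_map_shift_class(2)[OF walk inv])

lemma shift_add:
  assumes "f \<in> L2_fun \<nu>" "g \<in> L2_fun \<nu>"
  shows "AE x in \<nu>. shift z (\<lambda>x. f x + g x) x = shift z f x + shift z g x"
  using averaging_add[OF assms] by eventually_elim (simp add: shift_def algebra_simps)

lemma shift_diff: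
  assumes "f \<in> L2_fun \<nu>" "g \<in> L2_fun \<nu>"
  shows "AE x in \<nu>. shift z (\<lambda>x. f x - g x) x = shift z f x - shift z g x"
  using averaging_diff[OF assms] by eventually_elim (simp add: shift_def algebra_simps)

lemma var_norm_AE_cong:
  assumes "f \<in> L2_fun \<nu>" "g \<in> L2_fun \<nu>" "AE x in \<nu>. f x = g x"
  shows "var_norm \<nu> f = var_norm \<nu> g"
proof (rule var_norm_cong[OF prob_nu])
  have "AE x in \<nu>. f x = g x + 0" using assms(3) by simp
  with assms show "(f, g) \<in> mod_const \<nu>" unfolding mod_const_def by blast
qed

lemma var_norm_le_shift:
  assumes f: "f \<in> L2_fun \<nu>"
  shows "cmod z * var_norm \<nu> f \<le> var_norm \<nu> (averaging m f) + var_norm \<nu> (shift z f)"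
proof -
  have "cmod z * var_norm \<nu> f = var_norm \<nu> (\<lambda>x. averaging m f x + shift z f x)"
    by (simp add: shift_def nu.var_norm_cmult)
  also have "\<dots> \<le> var_norm \<nu> (averaging m f) + var_norm \<nu> (shift z f)"
    by (intro nu.var_norm_triangle averaging_L2 shift_L2 f)
  finally show ?thesis .
qed

text \<open>Reduces the resolvent condition to representatives. The lower bound gives injectivity
  and boundedness of the inverse at once; solvability up to a constant gives surjectivity.\<close>

lemma not_in_spectrumI:
  assumes below: "\<And>f. f \<in> L2_fun \<nu> \<Longrightarrow> var_norm \<nu> f \<le> D * var_norm \<nu> (shift z f)"
    and surj: "\<And>g. g \<in> L2_fun \<nu> \<Longrightarrow> \<exists>f\<in>L2_fun \<nu>. (shift z f, g) \<in> mod_const \<nu>"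
  shows "z \<notin> spectrum_mod_const \<nu> (averaging m)"
proof -
  let ?S = "quot_map \<nu> (\<lambda>f x. z * f x - averaging m f x)"
  have classE: "\<exists>f\<in>L2_fun \<nu>. F = mod_const \<nu> `` {f}" if "F \<in> L2_mod_const \<nu>" for F
    using that by (auto simp: L2_mod_const_def elim!: quotientE)
  have classI: "mod_const \<nu> `` {f} \<in> L2_mod_const \<nu>" if "f \<in> L2_fun \<nu>" for f
    using that by (simp add: L2_mod_const_def quotientI)
  have inj: "inj_on ?S (L2_mod_const \<nu>)"
  proof (rule inj_onI)
    fix F G assume "F \<in> L2_mod_const \<nu>" "G \<in> L2_mod_const \<nu>" and eq: "?S F = ?S G"
    then obtain f g where f: "f \<in> L2_fun \<nu>" "F = mod_const \<nu> `` {f}"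
      and g: "g \<in> L2_fun \<nu>" "G = mod_const \<nu> `` {g}"
      using classE by meson
    have "mod_const \<nu> `` {shift z f} = mod_const \<nu> `` {shift z g}"
      using eq f g by (simp add: quot_map_shift)
    then have "(shift z f, shift z g) \<in> mod_const \<nu>"
      by (rule eq_equiv_class[OF _ equiv_mod_const shift_L2[OF g(1)]])
    then have "var_norm \<nu> (\<lambda>x. shift z f x - shift z g x) = 0"
      by (simp add: nu.mod_const_iff_var_norm)
    also have "var_norm \<nu> (\<lambda>x. shift z f x - shift z g x) = var_norm \<nu> (shift z (\<lambda>x. f x - g x))"
      using shift_diff[OF f(1) g(1), of z]
      by (intro var_norm_AE_cong L2_fun_diff shift_L2 f(1) g(1)) (auto elim!: eventually_mono)
    finally have "var_norm \<nu> (\<lambda>x. f x - g x) \<le> 0"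
      using below[OF L2_fun_diff[OF f(1) g(1)]] by simp
    then have "(f, g) \<in> mod_const \<nu>"
      using f(1) g(1) nu.var_norm_nonneg[of "\<lambda>x. f x - g x"]
      by (simp add: nu.mod_const_iff_var_norm)
    then show "F = G" unfolding f(2) g(2) by (rule equiv_class_eq[OF equiv_mod_const])
  qed
  have "?S ` L2_mod_const \<nu> = L2_mod_const \<nu>"
  proof (intro equalityI subsetI)
    fix G assume "G \<in> ?S ` L2_mod_const \<nu>"
    then obtain F where F: "F \<in> L2_mod_const \<nu>" "G = ?S F" by blast
    obtain f where "f \<in> L2_fun \<nu>" "F = mod_const \<nu> `` {f}" using classE[OF F(1)] by blast
    with F(2) show "G \<in> L2_mod_const \<nu>" by (simp add: quot_map_shift classI shift_L2)
  next
    fix G assume "G \<in> L2_mod_const \<nu>"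
    then obtain g where g: "g \<in> L2_fun \<nu>" "G = mod_const \<nu> `` {g}" using classE by blast
    obtain f where f: "f \<in> L2_fun \<nu>" "(shift z f, g) \<in> mod_const \<nu>" using surj[OF g(1)] by blast
    have "?S (mod_const \<nu> `` {f}) = G"
      unfolding quot_map_shift[OF f(1)] g(2) by (rule equiv_class_eq[OF equiv_mod_const f(2)])
    then show "G \<in> ?S ` L2_mod_const \<nu>" using classI[OF f(1)] by blast
  qed
  with inj have "bij_betw ?S (L2_mod_const \<nu>) (L2_mod_const \<nu>)" by (simp add: bij_betw_def)
  moreover have "quot_norm \<nu> F \<le> D * quot_norm \<nu> (?S F)" if F: "F \<in> L2_mod_const \<nu>" for F
  proof -
    obtain f where f: "f \<in> L2_fun \<nu>" "F = mod_const \<nu> `` {f}" using classE[OF F] by blast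
    show ?thesis
      unfolding f(2) quot_map_shift[OF f(1)] quot_norm_class[OF prob_nu f(1)]
        quot_norm_class[OF prob_nu shift_L2[OF f(1)]]
      by (rule below[OF f(1)])
  qed
  ultimately show ?thesis by (auto simp: spectrum_mod_const_def Let_def)
qed

section \<open>Inverting z - M outside the disc of radius r\<close>

context
  fixes C r :: real and z :: complex
  assumes C: "0 \<le> C" and r: "0 \<le> r" "r < cmod z"
    and power_bound: "\<And>n f. f \<in> L2_fun \<nu> \<Longrightarrow> var_norm \<nu> ((averaging m ^^ n) f) \<le> C * r ^ n * var_norm \<nu> f"
begin

lemma averaging_bound: "f \<in> L2_fun \<nu> \<Longrightarrow> var_norm \<nu> (averaging m f) \<le> C * r * var_norm \<nu> f"
  using power_bound[of f 1] by simp

lemma power_ratio_tendsto_0: "(\<lambda>n. c * (r / cmod z) ^ n) \<longlonglongrightarrow> 0"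
  using r by (intro tendsto_mult_right_zero LIMSEQ_power_zero) (simp add: divide_less_eq)

text \<open>Iterates z f = M f + (z - M) f, using that M commutes with z - M, so every error term is
  controlled by (z - M) f. One step need not suffice, since C r may exceed |z|; C r^n falls below
  |z|^n only for large n.\<close>

lemma shift_bounded_below_power:
  "\<exists>D. \<forall>f\<in>L2_fun \<nu>. cmod z ^ n * var_norm \<nu> f
     \<le> var_norm \<nu> ((averaging m ^^ n) f) + D * var_norm \<nu> (shift z f)"
proof (induction n)
  case 0
  show ?case by (intro exI[of _ 0]) simp
next
  case (Suc n)
  then obtain D where D: "\<And>f. f \<in> L2_fun \<nu> \<Longrightarrow> cmod z ^ n * var_norm \<nu> f
     \<le> var_norm \<nu> ((averaging m ^^ n) f) + D * var_norm \<nu> (shift z f)" by blast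
  have "cmod z ^ Suc n * var_norm \<nu> f
      \<le> var_norm \<nu> ((averaging m ^^ Suc n) f) + (max D 0 * (C * r) + cmod z ^ n) * var_norm \<nu> (shift z f)"
    if f: "f \<in> L2_fun \<nu>" for f
  proof -
    have "AE x in \<nu>. shift z (averaging m f) x = averaging m (shift z f) x"
      using averaging_diff[OF L2_fun_cmult[OF f, of z] averaging_L2[OF f]]
      by eventually_elim (simp add: shift_def averaging_cmult)
    then have "var_norm \<nu> (shift z (averaging m f)) = var_norm \<nu> (averaging m (shift z f))"
      by (intro var_norm_AE_cong shift_L2 averaging_L2 f)
    also have "\<dots> \<le> C * r * var_norm \<nu> (shift z f)"
      by (intro averaging_bound shift_L2 f)
    finally have S: "var_norm \<nu> (shift z (averaging m f)) \<le> C * r * var_norm \<nu> (shift z f)" .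
    have "cmod z ^ Suc n * var_norm \<nu> f = cmod z ^ n * (cmod z * var_norm \<nu> f)" by simp
    also have "\<dots> \<le> cmod z ^ n * (var_norm \<nu> (averaging m f) + var_norm \<nu> (shift z f))"
      by (intro mult_left_mono var_norm_le_shift f) simp
    also have "\<dots> = cmod z ^ n * var_norm \<nu> (averaging m f) + cmod z ^ n * var_norm \<nu> (shift z f)"
      by (rule distrib_left)
    also have "cmod z ^ n * var_norm \<nu> (averaging m f)
        \<le> var_norm \<nu> ((averaging m ^^ n) (averaging m f)) + D * var_norm \<nu> (shift z (averaging m f))"
      by (rule D[OF averaging_L2[OF f]])
    \<comment> \<open>The induction hypothesis leaves the sign of \<open>D\<close> open, hence
      \<open>max D 0\<close>.\<close>
    also have "D * var_norm \<nu> (shift z (averaging m f)) \<le> max D 0 * (C * r * var_norm \<nu> (shift z f))"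
      using S by (intro mult_mono) auto
    finally show ?thesis by (simp add: funpow_swap1 algebra_simps)
  qed
  then show ?case by blast
qed

text \<open>Choose n so large that C r^n is at most |z|^n / 2; the term with M^n f is then absorbed
  into half of the left side.\<close>

lemma shift_bounded_below:
  "\<exists>D. \<forall>f\<in>L2_fun \<nu>. var_norm \<nu> f \<le> D * var_norm \<nu> (shift z f)"
proof -
  have z: "0 < cmod z" using r by linarith
  obtain n where n: "C * (r / cmod z) ^ n < 1 / 2"
    using order_tendstoD(2)[OF power_ratio_tendsto_0[of C], of "1 / 2"]
    by (auto simp: eventually_sequentially)
  then have n': "C * r ^ n \<le> cmod z ^ n / 2" using z by (simp add: power_divide field_simps)
  obtain D where D: "\<And>f. f \<in> L2_fun \<nu> \<Longrightarrow> cmod z ^ n * var_norm \<nu> f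
     \<le> var_norm \<nu> ((averaging m ^^ n) f) + D * var_norm \<nu> (shift z f)"
    using shift_bounded_below_power by blast
  have "var_norm \<nu> f \<le> (2 * D / cmod z ^ n) * var_norm \<nu> (shift z f)" if f: "f \<in> L2_fun \<nu>" for f
  proof -
    have "C * r ^ n * var_norm \<nu> f \<le> cmod z ^ n / 2 * var_norm \<nu> f"
      using n' by (intro mult_right_mono) auto
    with D[OF f] power_bound[OF f, of n]
    have "cmod z ^ n * var_norm \<nu> f \<le> 2 * D * var_norm \<nu> (shift z f)" by simp
    then show ?thesis using z by (simp add: field_simps)
  qed
  then show ?thesis by blast
qed

text \<open>The preimage of \<open>g\<close> is the Neumann series \<open>\<Sum>i. inverse (z ^ Suc i) * M\<^sup>i g\<close>.\<close>

lemma shift_surjective: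
  assumes g: "g \<in> L2_fun \<nu>"
  shows "\<exists>f\<in>L2_fun \<nu>. (shift z f, g) \<in> mod_const \<nu>"
proof -
  have z: "0 < cmod z" "z \<noteq> 0" using r by auto
  define q where "q = r / cmod z"
  have q: "0 \<le> q" "q < 1" using r z by (auto simp: q_def)
  define h where "h i = (\<lambda>x. inverse (z ^ Suc i) * (averaging m ^^ i) g x)" for i
  have hL2: "h i \<in> L2_fun \<nu>" for i
    unfolding h_def by (intro L2_fun_cmult averaging_power_L2 g)
  \<comment> \<open>This is the remainder (M / z)^n g left when z - M is applied to the first n
    terms of the series; it decays like q^n.\<close>
  have rem: "var_norm \<nu> (\<lambda>x. inverse (z ^ n) * (averaging m ^^ n) g x) \<le> C * var_norm \<nu> g * q ^ n" for n
  proof -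
    have "var_norm \<nu> (\<lambda>x. inverse (z ^ n) * (averaging m ^^ n) g x)
        = inverse (cmod z ^ n) * var_norm \<nu> ((averaging m ^^ n) g)"
      by (simp add: nu.var_norm_cmult norm_inverse norm_power)
    also have "\<dots> \<le> inverse (cmod z ^ n) * (C * r ^ n * var_norm \<nu> g)"
      by (intro mult_left_mono power_bound g) simp
    finally show ?thesis by (simp add: q_def power_divide field_simps)
  qed
  have sum: "summable (\<lambda>i. var_norm \<nu> (h i))"
  proof (rule summable_comparison_test')
    show "summable (\<lambda>i. inverse (cmod z) * (C * var_norm \<nu> g * q ^ i))"
      using q by (intro summable_mult summable_geometric) simp
    fix i
    have "h i = (\<lambda>x. inverse z * (inverse (z ^ i) * (averaging m ^^ i) g x))"
      by (simp add: h_def mult_ac)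
    then have "var_norm \<nu> (h i) = inverse (cmod z) * var_norm \<nu> (\<lambda>x. inverse (z ^ i) * (averaging m ^^ i) g x)"
      by (simp only: nu.var_norm_cmult norm_inverse)
    also have "\<dots> \<le> inverse (cmod z) * (C * var_norm \<nu> g * q ^ i)"
      by (intro mult_left_mono rem) simp
    finally show "norm (var_norm \<nu> (h i)) \<le> inverse (cmod z) * (C * var_norm \<nu> g * q ^ i)" by simp
  qed
  obtain f where f: "f \<in> L2_fun \<nu>"
    and tail: "\<And>n. var_norm \<nu> (\<lambda>x. f x - (\<Sum>i<n. h i x)) \<le> (\<Sum>i. var_norm \<nu> (h (i + n)))"
    using nu.var_norm_series_complete[OF hL2 sum] by blast
  define s where "s n = (\<lambda>x. \<Sum>i<n. h i x)" for n
  have sL2: "s n \<in> L2_fun \<nu>" for n unfolding s_def by (rule L2_fun_sum[OF prob_nu hL2])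
  \<comment> \<open>z - M sends the term \<open>h n\<close> to (M / z)^n g - (M / z)^(n+1) g. The
    identity holds almost everywhere because additivity of \<open>averaging\<close> on L2 functions
    is available only there.\<close>
  have telescope: "AE x in \<nu>. shift z (s n) x = g x - inverse (z ^ n) * (averaging m ^^ n) g x" for n
  proof (induction n)
    case 0
    show ?case by (simp add: s_def shift_def averaging_def)
  next
    case (Suc n)
    have "s (Suc n) = (\<lambda>x. s n x + h n x)" by (simp add: s_def)
    then have "AE x in \<nu>. shift z (s (Suc n)) x = shift z (s n) x + shift z (h n) x"
      using shift_add[OF sL2 hL2] by simp
    then show ?case
      using Suc
    proof eventually_elim
      case (elim x)
      have "shift z (h n) x = inverse (z ^ n) * (averaging m ^^ n) g x
          - inverse (z ^ Suc n) * (averaging m ^^ Suc n) g x"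
        unfolding shift_def h_def averaging_cmult using z(2) by simp
      with elim show ?case by simp
    qed
  qed
  \<comment> \<open>Split f into the partial sum \<open>s n\<close> and the tail \<open>u\<close>. z
    - M has seminorm at most |z| + C r on the tail, and the partial sum misses g by the remainder;
    both contributions vanish as n grows.\<close>
  have bound: "var_norm \<nu> (\<lambda>x. shift z f x - g x)
      \<le> (cmod z + C * r) * (\<Sum>i. var_norm \<nu> (h (i + n))) + C * var_norm \<nu> g * q ^ n" for n
  proof -
    define u where "u = (\<lambda>x. f x - s n x)"
    define e where "e = (\<lambda>x. inverse (z ^ n) * (averaging m ^^ n) g x)"
    have uL2: "u \<in> L2_fun \<nu>" unfolding u_def by (rule L2_fun_diff[OF f sL2])
    have eL2: "e \<in> L2_fun \<nu>" unfolding e_def by (intro L2_fun_cmult averaging_power_L2 g)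
    have "AE x in \<nu>. shift z f x - g x = shift z u x - e x"
      using shift_diff[OF f sL2, of z n] telescope[of n]
      by eventually_elim (simp add: u_def e_def)
    then have "var_norm \<nu> (\<lambda>x. shift z f x - g x) = var_norm \<nu> (\<lambda>x. shift z u x - e x)"
      by (intro var_norm_AE_cong L2_fun_diff shift_L2 f g uL2 eL2)
    also have "\<dots> \<le> var_norm \<nu> (shift z u) + var_norm \<nu> e"
      by (intro nu.var_norm_triangle_diff shift_L2 uL2 eL2)
    also have "var_norm \<nu> (shift z u) \<le> var_norm \<nu> (\<lambda>x. z * u x) + var_norm \<nu> (averaging m u)"
      unfolding shift_def by (intro nu.var_norm_triangle_diff L2_fun_cmult averaging_L2 uL2)
    also have "\<dots> \<le> (cmod z + C * r) * var_norm \<nu> u"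
      using averaging_bound[OF uL2] by (simp add: nu.var_norm_cmult distrib_right)
    also have "\<dots> \<le> (cmod z + C * r) * (\<Sum>i. var_norm \<nu> (h (i + n)))"
      using tail[of n] C r by (intro mult_left_mono) (simp_all add: u_def s_def)
    also have "var_norm \<nu> e \<le> C * var_norm \<nu> g * q ^ n" unfolding e_def by (rule rem)
    finally show ?thesis by simp
  qed
  have "(\<lambda>n. (\<Sum>i. var_norm \<nu> (h i)) - (\<Sum>i<n. var_norm \<nu> (h i))) \<longlonglongrightarrow>
      (\<Sum>i. var_norm \<nu> (h i)) - (\<Sum>i. var_norm \<nu> (h i))"
    by (intro tendsto_intros summable_LIMSEQ sum)
  then have "(\<lambda>n. \<Sum>i. var_norm \<nu> (h (i + n))) \<longlonglongrightarrow> 0"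
    by (simp add: suminf_minus_initial_segment[OF sum])
  then have "(\<lambda>n. (cmod z + C * r) * (\<Sum>i. var_norm \<nu> (h (i + n))) + C * var_norm \<nu> g * q ^ n)
      \<longlonglongrightarrow> (cmod z + C * r) * 0 + 0"
    unfolding q_def by (intro tendsto_intros power_ratio_tendsto_0)
  then have "var_norm \<nu> (\<lambda>x. shift z f x - g x) \<le> (cmod z + C * r) * 0 + 0"
    by (rule LIMSEQ_le_const) (use bound in blast)
  then have "(shift z f, g) \<in> mod_const \<nu>"
    using f g shift_L2 nu.var_norm_nonneg[of "\<lambda>x. shift z f x - g x"]
    by (simp add: nu.mod_const_iff_var_norm)
  with f show ?thesis by blast
qed

lemma not_in_spectrum_of_power_bound: "z \<notin> spectrum_mod_const \<nu> (averaging m)"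
  using shift_bounded_below not_in_spectrumI[OF _ shift_surjective] by blast

end

text \<open>On a one-point space all functions differ by constants, so the quotient is a single
  class, on which every z - M is bijective with bounded inverse.\<close>

lemma spectrum_trivial:
  assumes triv: "\<And>x y :: 'a. x = y"
  shows "spectrum_mod_const \<nu> (averaging m) = {}"
proof -
  have mod: "(f, g) \<in> mod_const \<nu>" if "f \<in> L2_fun \<nu>" "g \<in> L2_fun \<nu>" for f g
  proof -
    have "f x = g x + (f undefined - g undefined)" for x
      unfolding triv[of x undefined] by simp
    then have "AE x in \<nu>. f x = g x + (f undefined - g undefined)" by (rule AE_I2)
    with that show ?thesis unfolding mod_const_def by blast
  qed
  have "z \<notin> spectrum_mod_const \<nu> (averaging m)" for z
  proof (rule not_in_spectrumI[where D = 0])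
    fix f assume f: "f \<in> L2_fun \<nu>"
    have "(f, \<lambda>x. 0) \<in> mod_const \<nu>" by (rule mod[OF f L2_fun_const[OF prob_nu]])
    from var_norm_cong[OF prob_nu this] show "var_norm \<nu> f \<le> 0 * var_norm \<nu> (shift z f)"
      by (simp add: var_norm_def)
    show "\<exists>g\<in>L2_fun \<nu>. (shift z g, f) \<in> mod_const \<nu>" using f mod shift_L2 by blast
  qed
  then show ?thesis by blast
qed

end

theorem proposition29:
  fixes m :: "'a::polish_space \<Rightarrow> 'a measure" and \<nu> :: "'a measure" and \<kappa> :: real
  assumes "random_walk m"
    and "invariant_distribution m \<nu>"
    and "\<kappa> > 0"
    and "ricci_at_least m \<kappa>"
    and "average_spread m \<nu> < \<infinity>"
    and "reversible m \<nu> \<or> finite (UNIV :: 'a set)"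
  shows "spectral_radius_mod_const \<nu> (averaging m) \<le> ereal (1 - \<kappa>)"
proof -
  interpret invariant_walk m \<nu> by unfold_locales fact+
  show ?thesis
  \<comment> \<open>On a one-point space the curvature bound is vacuous and \<kappa> may exceed 1;
    there the spectrum is empty and the supremum is minus infinity.\<close>
  proof (cases "\<forall>x y :: 'a. x = y")
    case True
    then show ?thesis
      using spectrum_trivial by (simp add: spectral_radius_mod_const_def bot_ereal_def)
  next
    case False
    \<comment> \<open>Two distinct points force \<kappa> \<le> 1, because the transportation
      distance is nonnegative. Hence 1 - \<kappa> can serve as a Lipschitz factor and as a
      radius.\<close>
    then obtain x y :: 'a where "x \<noteq> y" by blast
    then have "\<kappa> \<le> ricci m x y" using assms by (simp add: ricci_at_least_def)
    also have "\<dots> \<le> 1" by (simp add: ricci_def)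
    finally have k1: "\<kappa> \<le> 1" .
    interpret positively_curved_walk m \<nu> \<kappa>
      using assms k1 by unfold_locales auto
    \<comment> \<open>Both alternatives end in the same bound on the powers of M, the reversible one
      with C = 1; the spectral argument depends only on this bound.\<close>
    have "\<exists>C\<ge>0. \<forall>n. \<forall>f\<in>L2_fun \<nu>. var_norm \<nu> ((averaging m ^^ n) f) \<le> C * (1 - \<kappa>) ^ n * var_norm \<nu> f"
    proof (cases "reversible m \<nu>")
      case True
      then show ?thesis using reversible_power_bound by (intro exI[of _ 1]) simp
    next
      case False
      then show ?thesis using assms by (intro finite_power_bound) simp
    qed
    then obtain C where C: "0 \<le> C" "\<And>n f. f \<in> L2_fun \<nu> \<Longrightarrow>
        var_norm \<nu> ((averaging m ^^ n) f) \<le> C * (1 - \<kappa>) ^ n * var_norm \<nu> f"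
      by blast
    show ?thesis
      unfolding spectral_radius_mod_const_def
    proof (rule SUP_least)
      fix z assume z: "z \<in> spectrum_mod_const \<nu> (averaging m)"
      have "\<not> 1 - \<kappa> < cmod z"
        using not_in_spectrum_of_power_bound[OF C(1) _ _ C(2), of z] z k1 by auto
      then show "ereal (cmod z) \<le> ereal (1 - \<kappa>)" by simp
    qed
  qed
qed

end
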